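(* Let $(b_n)_{n\ge1}$ be a sequence of positive reals satisfying $b_n=1-\frac{\mathrm{w}}{n^2}+\mathcal{O}(n^{-2-\zeta})$ as $n\to\infty$ for some $1\ge\zeta>0$, with $-3/8<\mathrm{w}<1/8$, and suppose that the matrix $R$ is $1$-transient. Then, with $\theta=1-\frac{\sqrt{1-8\mathrm{w}}}{2}$, the sequences $(\mathfrak{w}_p(1+\epsilon))_{p\ge1}$, $\epsilon>0$, satisfy $$0<\liminf_{\epsilon\searrow0}\ \epsilon^{\theta}\sum_{p=1}^{\infty}\mathfrak{w}_p(1+\epsilon)^2\ \le\ \limsup_{\epsilon\searrow0}\ \epsilon^{\theta}\sum_{p=1}^{\infty}\mathfrak{w}_p(1+\epsilon)^2<\infty .$$
   Context: Matrix $R$: for sequences $w=(w_p)_{p\ge1}$, $(Rw)_1=\frac{w_2}{2\sqrt{b_1b_2}}$ and $(Rw)_p=\frac{w_{p+1}}{2\sqrt{b_pb_{p+1}}}+\frac{w_{p-1}}{2\sqrt{b_pb_{p-1}}}$ for $p>1$. $R$ is $\rho$-transient if the equation $Rw=\rho w-\mathbf{1}_{p=1}$ has a solution with all $w_p>0$ (for $\rho=1$, equivalently $\sum_n (R^n)_{1,1}<\infty$). For $\rho>0$, $\mathfrak{w}_1(\rho)=\inf\{w_1: w_p>0\ \forall p\ge 1,\ Rw=\rho w-\mathbf{1}_{p=1}\}$ (with $\inf\emptyset=\infty$). When $\mathfrak{w}_1(\rho)<\infty$, $(\mathfrak{w}_p(\rho))_{p\ge1}$ denotes the (positive) solution of $R\mathfrak{w}=\rho\mathfrak{w}-\mathbf{1}_{p=1}$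 with first entry $\mathfrak{w}_1(\rho)$. *)

theory Defs
  imports "HOL-Analysis.Analysis" "HOL-Library.Landau_Symbols"
begin

text \<open>Sequences are indexed by \<open>p \<ge> 1\<close>; the entry at index 0 of a function on \<open>nat\<close> is
  never used.\<close>

definition R_mat :: "(nat \<Rightarrow> real) \<Rightarrow> (nat \<Rightarrow> real) \<Rightarrow> nat \<Rightarrow> real" where
  "R_mat b w p =
     (if p = 1 then w 2 / (2 * sqrt (b 1 * b 2))
      else w (p + 1) / (2 * sqrt (b p * b (p + 1))) + w (p - 1) / (2 * sqrt (b p * b (p - 1))))"

definition pos_solution :: "(nat \<Rightarrow> real) \<Rightarrow> real \<Rightarrow> (nat \<Rightarrow> real) \<Rightarrow> bool" where
  "pos_solution b \<rho> w \<longleftrightarrow>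
     (\<forall>p\<ge>1. w p > 0) \<and> (\<forall>p\<ge>1. R_mat b w p = \<rho> * w p - (if p = 1 then 1 else 0))"

definition R_transient :: "(nat \<Rightarrow> real) \<Rightarrow> real \<Rightarrow> bool" where
  "R_transient b \<rho> \<longleftrightarrow> (\<exists>w. pos_solution b \<rho> w)"

text \<open>In \<open>ereal\<close> the infimum of the empty set is \<open>\<infinity>\<close>.\<close>

definition min_first :: "(nat \<Rightarrow> real) \<Rightarrow> real \<Rightarrow> ereal" where
  "min_first b \<rho> = Inf {ereal (w 1) |w. pos_solution b \<rho> w}"

text \<open>The unused entry at index 0 is fixed to be 0, so that the solution is unique as a function;
  lemma \<open>min_solution\<close> below shows that it exists whenever \<open>min_first b \<rho> < \<infinity>\<close>.\<close>

definition min_sol :: "(nat \<Rightarrow> real) \<Rightarrow> real \<Rightarrow> nat \<Rightarrow> real" where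
  "min_sol b \<rho> = (THE w. pos_solution b \<rho> w \<and> ereal (w 1) = min_first b \<rho> \<and> w 0 = 0)"

text \<open>The sequence with first entry \<open>x\<close> obtained by solving the equation forwards; it serves only
  to prove that \<open>min_sol\<close> is well defined.\<close>

fun shoot :: "(nat \<Rightarrow> real) \<Rightarrow> real \<Rightarrow> real \<Rightarrow> nat \<Rightarrow> real" where
  "shoot b \<rho> x 0 = 0"
| "shoot b \<rho> x (Suc 0) = x"
| "shoot b \<rho> x (Suc (Suc 0)) = 2 * sqrt (b 1 * b 2) * (\<rho> * x - 1)"
| "shoot b \<rho> x (Suc (Suc (Suc n))) =
     2 * sqrt (b (n + 2) * b (n + 3)) *
       (\<rho> * shoot b \<rho> x (Suc (Suc n)) - shoot b \<rho> x (Suc n) / (2 * sqrt (b (n + 2) * b (n + 1))))"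

lemma shoot_solves:
  assumes b: "\<And>n. n \<ge> 1 \<Longrightarrow> b n > 0" and "p \<ge> 1"
  shows "R_mat b (shoot b \<rho> x) p = \<rho> * shoot b \<rho> x p - (if p = 1 then 1 else 0)"
proof -
  obtain q where q: "p = Suc q" using \<open>p \<ge> 1\<close> by (cases p) auto
  show ?thesis
  proof (cases q)
    case 0
    have "b 1 > 0" "b 2 > 0" using b by auto
    then show ?thesis using 0 q by (simp add: R_mat_def numeral_2_eq_2)
  next
    case (Suc n)
    have "b (n + 1) > 0" "b (n + 2) > 0" "b (n + 3) > 0" using b by auto
    then show ?thesis using Suc q by (simp add: R_mat_def numeral_eq_Suc)
  qed
qed

lemma solution_eq_shoot:
  assumes b: "\<And>n. n \<ge> 1 \<Longrightarrow> b n > 0"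
    and w: "\<And>p. p \<ge> 1 \<Longrightarrow> R_mat b w p = \<rho> * w p - (if p = 1 then 1 else 0)"
    and "p \<ge> 1"
  shows "w p = shoot b \<rho> (w 1) p"
  using \<open>p \<ge> 1\<close>
proof (induction p rule: less_induct)
  case (less p)
  consider "p = 1" | "p = 2" | n where "p = Suc (Suc (Suc n))"
    using less.prems by (metis One_nat_def numeral_2_eq_2 not0_implies_Suc not_one_le_zero)
  then show ?case
  proof cases
    case 1
    then show ?thesis by simp
  next
    case 2
    have "b 1 > 0" "b 2 > 0" using b by auto
    then show ?thesis using 2 w[of 1] by (simp add: R_mat_def numeral_2_eq_2 field_simps)
  next
    case (3 n)
    have pos: "b (n + 1) > 0" "b (n + 2) > 0" "b (n + 3) > 0" using b by auto
    have IH: "shoot b \<rho> (w 1) (Suc n) = w (Suc n)" "shoot b \<rho> (w 1) (Suc (Suc n)) = w (Suc (Suc n))"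
      using less.IH[of "Suc n"] less.IH[of "Suc (Suc n)"] 3 by auto
    define s where "s = 2 * sqrt (b (n + 2) * b (n + 3))"
    have "s > 0" using pos by (simp add: s_def)
    have "w (n + 3) / s + w (n + 1) / (2 * sqrt (b (n + 2) * b (n + 1))) = \<rho> * w (n + 2)"
      using w[of "n + 2"] by (simp add: R_mat_def s_def numeral_eq_Suc)
    then have "w (n + 3) = s * (\<rho> * w (n + 2) - w (n + 1) / (2 * sqrt (b (n + 2) * b (n + 1))))"
      using \<open>s > 0\<close> by (simp add: field_simps)
    then show ?thesis using 3 IH by (simp add: s_def numeral_eq_Suc)
  qed
qed

lemma continuous_shoot: "continuous_on UNIV (\<lambda>x. shoot b \<rho> x p)"
proof (induction p rule: less_induct)
  case (less p)
  consider "p = 0" | "p = Suc 0" | "p = Suc (Suc 0)" | n where "p = Suc (Suc (Suc n))"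
    by (metis not0_implies_Suc)
  then show ?case
  proof cases
    case (4 n)
    have "continuous_on UNIV (\<lambda>x. shoot b \<rho> x (Suc n))"
      "continuous_on UNIV (\<lambda>x. shoot b \<rho> x (Suc (Suc n)))"
      using less.IH 4 by auto
    then show ?thesis
      unfolding 4 shoot.simps divide_inverse by (intro continuous_intros)
  qed (simp_all add: continuous_intros)
qed

lemma min_solution:
  assumes b: "\<And>n. n \<ge> 1 \<Longrightarrow> b n > 0" and fin: "min_first b \<rho> < \<infinity>"
  shows "pos_solution b \<rho> (min_sol b \<rho>) \<and> ereal (min_sol b \<rho> 1) = min_first b \<rho> \<and> min_sol b \<rho> 0 = 0"
proof -
  define S where "S = {w 1 |w. pos_solution b \<rho> w}"
  have S_ereal: "{ereal (w 1) |w. pos_solution b \<rho> w} = ereal ` S" by (auto simp: S_def)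
  have ne: "S \<noteq> {}"
  proof
    assume "S = {}"
    then have "min_first b \<rho> = \<infinity>" unfolding min_first_def S_ereal by (simp add: top_ereal_def)
    then show False using fin by simp
  qed
  have Spos: "x > 0" if "x \<in> S" for x using that by (auto simp: S_def pos_solution_def)
  then have bdd: "bdd_below S" by (meson bdd_belowI less_imp_le)
  define a where "a = Inf S"
  have a: "min_first b \<rho> = ereal a"
    unfolding min_first_def S_ereal a_def
    using ne Spos ereal_Inf'[OF bdd ne] by simp
  have acl: "a \<in> closure S" unfolding a_def by (rule closure_contains_Inf[OF ne bdd])
  define v where "v = shoot b \<rho> a"
  have nonneg: "v p \<ge> 0" if "p \<ge> 1" for p
  proof -
    have "S \<subseteq> {x. shoot b \<rho> x p \<ge> 0}"
    proof
      fix x assume "x \<in> S"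
      then obtain w where w: "pos_solution b \<rho> w" "x = w 1" by (auto simp: S_def)
      have "w p = shoot b \<rho> (w 1) p"
        using w(1) that by (intro solution_eq_shoot[OF b]) (auto simp: pos_solution_def)
      moreover have "w p > 0" using w(1) that by (simp add: pos_solution_def)
      ultimately show "x \<in> {x. shoot b \<rho> x p \<ge> 0}" using w(2) by simp
    qed
    moreover have "closed {x. shoot b \<rho> x p \<ge> 0}"
      by (intro closed_Collect_le continuous_on_const continuous_shoot)
    ultimately have "closure S \<subseteq> {x. shoot b \<rho> x p \<ge> 0}" by (rule closure_minimal)
    then show ?thesis using acl by (auto simp: v_def)
  qed
  have sol: "R_mat b v p = \<rho> * v p - (if p = 1 then 1 else 0)" if "p \<ge> 1" for p
    unfolding v_def using b that by (rule shoot_solves)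
  have pos: "v p > 0" if "p \<ge> 1" for p
    using that
  proof (induction p rule: nat_induct_at_least)
    case base
    have "v 1 \<noteq> 0"
    proof
      assume "v 1 = 0"
      then have "v 2 / (2 * sqrt (b 1 * b 2)) = -1" using sol[of 1] by (simp add: R_mat_def)
      moreover have "v 2 / (2 * sqrt (b 1 * b 2)) \<ge> 0"
        using nonneg[of 2] b[of 1] b[of 2] by simp
      ultimately show False by simp
    qed
    then show ?case using nonneg[of 1] by simp
  next
    case (Suc n)
    have "v (Suc n) \<noteq> 0"
    proof
      assume "v (Suc n) = 0"
      then have "v (Suc n + 1) / (2 * sqrt (b (Suc n) * b (Suc n + 1))) +
                 v n / (2 * sqrt (b (Suc n) * b n)) = 0"
        using sol[of "Suc n"] Suc.hyps by (simp add: R_mat_def)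
      moreover have "v (Suc n + 1) / (2 * sqrt (b (Suc n) * b (Suc n + 1))) \<ge> 0"
        using nonneg[of "Suc n + 1"] b[of "Suc n"] b[of "Suc n + 1"] by simp
      moreover have "v n / (2 * sqrt (b (Suc n) * b n)) > 0"
        using Suc.IH Suc.hyps b[of "Suc n"] b[of n] by simp
      ultimately show False by linarith
    qed
    then show ?case using nonneg[of "Suc n"] by simp
  qed
  have "\<exists>!w. pos_solution b \<rho> w \<and> ereal (w 1) = min_first b \<rho> \<and> w 0 = 0"
  proof (rule ex1I[of _ v])
    show "pos_solution b \<rho> v \<and> ereal (v 1) = min_first b \<rho> \<and> v 0 = 0"
      using pos sol a by (auto simp: pos_solution_def v_def)
  next
    fix w assume w: "pos_solution b \<rho> w \<and> ereal (w 1) = min_first b \<rho> \<and> w 0 = 0"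
    have "w p = v p" for p
    proof (cases "p \<ge> 1")
      case True
      then have "w p = shoot b \<rho> (w 1) p"
        using w by (intro solution_eq_shoot[OF b]) (auto simp: pos_solution_def)
      then show ?thesis using w a by (simp add: v_def)
    next
      case False
      then have "p = 0" by simp
      then show ?thesis using w by (simp add: v_def)
    qed
    then show "w = v" by blast
  qed
  from theI'[OF this] show ?thesis unfolding min_sol_def .
qed

end

theory Submission imports Defs "HOL-Real_Asymp.Real_Asymp" begin

text \<open>Writing \<open>w p = sqrt (b p) * u p\<close>, the equation becomes \<open>u (p + 1) + u (p - 1) = 2 * \<rho> * b p * u p\<close>,
  a discrete Schroedinger equation with inverse square potential. At \<open>\<rho> = 1\<close> its solutions grow like
  \<open>p powr ((1 \<plusminus> s) / 2)\<close> with \<open>s = sqrt (1 - 8 w)\<close>, and the minimal solution \<open>h\<close> at \<open>\<rho> = 1 + \<epsilon>\<close> follows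
  the smaller exponent \<open>a = (1 - s) / 2\<close> up to the scale \<open>p \<sim> \<epsilon> powr (-1/2)\<close>, beyond which it decays.
  Hence \<open>\<Sum>p. (h p)\<^sup>2\<close> is of order \<open>(\<epsilon> powr (-1/2)) powr (2 * a + 1) = \<epsilon> powr (- \<theta>)\<close>. Transience provides a
  positive solution \<open>g\<close> at \<open>\<rho> = 1\<close>, and with it a comparison principle; both bounds on \<open>h\<close> then come from
  explicit barriers built from perturbed powers of \<open>p\<close>.\<close>

section \<open>The renormalised second-order recurrence\<close>

text \<open>The sign is chosen so that a nonnegative defect marks a supersolution and a nonpositive
  one a subsolution.\<close>

definition defect :: "(nat \<Rightarrow> real) \<Rightarrow> real \<Rightarrow> (nat \<Rightarrow> real) \<Rightarrow> nat \<Rightarrow> real" where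
  "defect b \<rho> u p = 2 * \<rho> * b p * u p - u (p + 1) - u (p - 1)"

text \<open>Competitors share the value at 0, which encodes the source term, so minimality of
  \<open>h 1\<close> among them mirrors the infimum in \<open>min_first\<close>.\<close>

definition minimal_harmonic :: "(nat \<Rightarrow> real) \<Rightarrow> real \<Rightarrow> (nat \<Rightarrow> real) \<Rightarrow> bool" where
  "minimal_harmonic b \<rho> h \<longleftrightarrow> (\<forall>p. h p > 0) \<and> (\<forall>p\<ge>1. defect b \<rho> h p = 0) \<and>
     (\<forall>u. (\<forall>p. u p > 0) \<longrightarrow> (\<forall>p\<ge>1. defect b \<rho> u p = 0) \<longrightarrow> u 0 = h 0 \<longrightarrow> h 1 \<le> u 1)"

lemma defect_linear:
  "defect b \<rho> (\<lambda>p. x * u p + y * v p) p = x * defect b \<rho> u p + y * defect b \<rho> v p"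
  by (simp add: defect_def algebra_simps)

lemma defect_scale: "defect b \<rho> (\<lambda>p. x * u p) p = x * defect b \<rho> u p"
  by (simp add: defect_def algebra_simps)

text \<open>For positive \<open>b p\<close> the added term has the sign of \<open>u p\<close>, so
  positive supersolutions at 1 remain supersolutions at \<open>1 + \<epsilon>\<close>.\<close>

lemma defect_shift: "defect b (1 + \<epsilon>) u p = defect b 1 u p + 2 * \<epsilon> * b p * u p"
  by (simp add: defect_def algebra_simps)

text \<open>The source term of the equation at \<open>p = 1\<close> is absorbed into the value at 0, so that the
  renormalised sequence solves the homogeneous equation for all \<open>p \<ge> 1\<close>.\<close>
definition renorm :: "(nat \<Rightarrow> real) \<Rightarrow> (nat \<Rightarrow> real) \<Rightarrow> nat \<Rightarrow> real" where
  "renorm b w p = (if p = 0 then 2 * sqrt (b 1) else w p / sqrt (b p))"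

lemma pos_solution_iff_renorm:
  assumes b: "\<And>n. n \<ge> 1 \<Longrightarrow> b n > 0"
  shows "pos_solution b \<rho> w \<longleftrightarrow>
    (\<forall>p. renorm b w p > 0) \<and> (\<forall>p\<ge>1. defect b \<rho> (renorm b w) p = 0)"
proof -
  have pos: "(\<forall>p\<ge>1. w p > 0) \<longleftrightarrow> (\<forall>p. renorm b w p > 0)"
    using b by (auto simp: renorm_def zero_less_divide_iff Suc_le_eq split: if_splits
        dest: less_imp_le) (metis less_le_not_le)
  have eq: "R_mat b w p = \<rho> * w p - (if p = 1 then 1 else 0) \<longleftrightarrow> defect b \<rho> (renorm b w) p = 0"
    if "p \<ge> 1" for p
  proof -
    define t where "t = sqrt (b p)"
    have t: "t > 0" "t * t = b p" using b[OF that] by (auto simp: t_def)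
    have "defect b \<rho> (renorm b w) p =
      2 * t * (\<rho> * w p - (if p = 1 then 1 else 0) - R_mat b w p)"
    proof (cases "p = 1")
      case True
      then have "sqrt (b (Suc 0)) = t" "b (Suc 0) = t * t" using t by (auto simp: t_def)
      with True t(1) b[of 2] show ?thesis
        by (auto simp: defect_def renorm_def R_mat_def real_sqrt_mult field_simps numeral_2_eq_2)
    next
      case False
      then have "b (p - 1) > 0" "b (p + 1) > 0" using that b by auto
      then show ?thesis using False that t
        by (auto simp: defect_def renorm_def R_mat_def real_sqrt_mult t_def[symmetric] field_simps)
    qed
    then show ?thesis using t by auto
  qed
  show ?thesis unfolding pos_solution_def pos using eq by auto
qed

lemma renorm_surj:
  assumes b: "\<And>n. n \<ge> 1 \<Longrightarrow> b n > 0" and "u 0 = 2 * sqrt (b 1)"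
  shows "renorm b (\<lambda>p. sqrt (b p) * u p) = u"
proof
  fix p show "renorm b (\<lambda>p. sqrt (b p) * u p) p = u p"
    using assms(2) b[of p] by (cases "p = 0") (auto simp: renorm_def)
qed

text \<open>Both initial values are free: the data 0, 1 give the dominant solution, and the data of
  a positive solution at \<rho> = 1 give one that stays positive at
  \<open>1 + \<epsilon>\<close>.\<close>

fun harmonic_from :: "(nat \<Rightarrow> real) \<Rightarrow> real \<Rightarrow> real \<Rightarrow> real \<Rightarrow> nat \<Rightarrow> real" where
  "harmonic_from b \<rho> x y 0 = x"
| "harmonic_from b \<rho> x y (Suc 0) = y"
| "harmonic_from b \<rho> x y (Suc (Suc p)) =
     2 * \<rho> * b (Suc p) * harmonic_from b \<rho> x y (Suc p) - harmonic_from b \<rho> x y p"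

lemma defect_harmonic_from: "p \<ge> 1 \<Longrightarrow> defect b \<rho> (harmonic_from b \<rho> x y) p = 0"
  by (cases p) (auto simp: defect_def)

section \<open>Comparison principle from a positive solution at \<rho> = 1\<close>

text \<open>Transience in renormalised form: in the application \<open>g\<close> is
  \<open>renorm b v\<close> for a positive solution \<open>v\<close> at \<rho> = 1.\<close>

locale positive_harmonic =
  fixes b g :: "nat \<Rightarrow> real"
  assumes b_pos: "p \<ge> 1 \<Longrightarrow> b p > 0"
    and g_pos: "g p > 0"
    and g_harmonic: "p \<ge> 1 \<Longrightarrow> defect b 1 g p = 0"
begin

lemma nonneg_on_interval:
  assumes eps: "\<epsilon> > 0" and ends: "k P \<ge> 0" "k N \<ge> 0"
    and super: "\<And>p. P < p \<Longrightarrow> p < N \<Longrightarrow> defect b (1 + \<epsilon>) k p \<ge> 0"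
    and q: "P \<le> q" "q \<le> N"
  shows "k q \<ge> 0"
proof (rule ccontr)
  assume "\<not> k q \<ge> 0"
  \<comment> \<open>\<open>g\<close> is a strict supersolution at \<open>1 + \<epsilon>\<close>, so \<open>k / g\<close> has no negative interior minimum.\<close>
  define r where "r p = k p / g p" for p
  define m where "m = arg_min_on r {P..N}"
  have fin: "finite {P..N}" "{P..N} \<noteq> {}" using q by auto
  have m: "m \<in> {P..N}" unfolding m_def using fin by (rule arg_min_if_finite)
  have min: "r m \<le> r p" if "p \<in> {P..N}" for p
    unfolding m_def using fin that by (rule arg_min_least)
  have "r q < 0" using \<open>\<not> k q \<ge> 0\<close> g_pos[of q] by (simp add: r_def divide_less_0_iff)
  with min[of q] q have neg: "r m < 0" by simp
  then have "k m < 0" using g_pos[of m] by (simp add: r_def divide_less_0_iff)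
  with ends m have in1: "P < m" "m < N"
    using order_le_less by fastforce+
  have k: "k p = r p * g p" for p using g_pos[of p] by (simp add: r_def)
  have "m - 1 \<in> {P..N}" using in1 by auto
  then have "k (m + 1) \<ge> r m * g (m + 1)" "k (m - 1) \<ge> r m * g (m - 1)"
    unfolding k[of "m+1"] k[of "m-1"] using min[of "m+1"] min[of "m-1"] in1 g_pos
    by (auto intro!: mult_right_mono less_imp_le[OF g_pos])
  \<comment> \<open>At \<open>m\<close> the sequences \<open>k\<close> and \<open>r m * g\<close>
    agree, at both neighbours \<open>k\<close> lies above, and neighbours enter the defect with a
    minus sign.\<close>
  then have "defect b (1 + \<epsilon>) k m \<le> r m * defect b (1 + \<epsilon>) g m"
    unfolding defect_def k[of m] by (simp add: algebra_simps)
  also have "\<dots> = r m * (2 * \<epsilon> * b m * g m)"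
    using in1 by (simp add: defect_shift g_harmonic)
  also have "\<dots> < 0" using neg eps b_pos[of m] g_pos[of m] in1 by (intro mult_neg_pos) auto
  finally show False using super[OF in1] by simp
qed

text \<open>Monotone growth of \<open>u / g\<close> preserves positivity, so the induction carries
  it as a Wronskian inequality; each step adds
  \<open>2 * \<epsilon> * b (Suc p) * u (Suc p) * g (Suc p)\<close>, which is nonnegative.\<close>

lemma harmonic_from_pos:
  assumes eps: "\<epsilon> > 0" and xy: "x \<ge> 0" "y > 0" "y * g 0 \<ge> x * g 1"
  shows "harmonic_from b (1 + \<epsilon>) x y (Suc p) > 0"
proof -
  define u where "u = harmonic_from b (1 + \<epsilon>) x y"
  have "u (Suc p) > 0 \<and> u (Suc p) * g p \<ge> u p * g (Suc p)"
  proof (induction p)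
    case 0
    then show ?case using xy by (simp add: u_def)
  next
    case (Suc p)
    have eq: "u (Suc (Suc p)) = 2 * (1 + \<epsilon>) * b (Suc p) * u (Suc p) - u p" by (simp add: u_def)
    have g: "g (Suc (Suc p)) = 2 * b (Suc p) * g (Suc p) - g p"
      using g_harmonic[of "Suc p"] by (simp add: defect_def)
    have "0 \<le> 2 * \<epsilon> * b (Suc p) * u (Suc p) * g (Suc p)"
      using Suc eps b_pos[of "Suc p"] g_pos[of "Suc p"] by simp
    then have W: "u (Suc (Suc p)) * g (Suc p) \<ge> u (Suc p) * g (Suc (Suc p))"
      unfolding eq g using Suc by (simp add: algebra_simps)
    moreover have "u (Suc p) * g (Suc (Suc p)) > 0" using Suc g_pos by simp
    ultimately have "u (Suc (Suc p)) * g (Suc p) > 0" by linarith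
    then show ?case using W g_pos[of "Suc p"] by (simp add: zero_less_mult_iff)
  qed
  then show ?thesis by (simp add: u_def)
qed

text \<open>Otherwise a multiple of the dominant solution \<open>harmonic_from b (1 + \<epsilon>) 0 1\<close> could be subtracted from
  \<open>h\<close>, keeping it positive and lowering \<open>h 1\<close>. The ratio is monotone because the Wronskian is constant.\<close>
lemma minimal_ratio_small:
  assumes eps: "\<epsilon> > 0" and h: "minimal_harmonic b (1 + \<epsilon>) h" and "\<delta> > 0"
  shows "\<exists>N\<ge>q. h N \<le> \<delta> * harmonic_from b (1 + \<epsilon>) 0 1 N"
proof -
  define \<phi> where "\<phi> = harmonic_from b (1 + \<epsilon>) 0 1"
  have phi_pos: "\<phi> (Suc p) > 0" for p
    unfolding \<phi>_def using eps g_pos[of 0] by (intro harmonic_from_pos) auto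
  have phi: "\<phi> (Suc (Suc p)) = 2 * (1 + \<epsilon>) * b (Suc p) * \<phi> (Suc p) - \<phi> p"
    "\<phi> 0 = 0" "\<phi> (Suc 0) = 1" for p by (simp_all add: \<phi>_def)
  have h_pos: "h p > 0" for p using h by (simp add: minimal_harmonic_def)
  have hh: "p \<ge> 1 \<Longrightarrow> defect b (1 + \<epsilon>) h p = 0" for p using h by (simp add: minimal_harmonic_def)
  have h_eq: "h (Suc (Suc p)) = 2 * (1 + \<epsilon>) * b (Suc p) * h (Suc p) - h p" for p
    using hh[of "Suc p"] by (simp add: defect_def)
  have W: "h (Suc p) * \<phi> p - \<phi> (Suc p) * h p = - h 0" for p
  proof (induction p)
    case (Suc p)
    then show ?case unfolding phi h_eq by (simp add: algebra_simps)
  qed (simp add: phi)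
  have step: "h (Suc (Suc p)) / \<phi> (Suc (Suc p)) \<le> h (Suc p) / \<phi> (Suc p)" for p
    using W[of "Suc p"] h_pos[of 0] phi_pos[of p] phi_pos[of "Suc p"]
    by (simp add: divide_simps algebra_simps)
  \<comment> \<open>The shift by one avoids division by \<open>\<phi> 0 = 0\<close>.\<close>
  have dec: "decseq (\<lambda>p. h (Suc p) / \<phi> (Suc p))" using step by (intro decseq_SucI) auto
  have "\<exists>N. h (Suc N) \<le> \<delta> * \<phi> (Suc N)"
  proof (rule ccontr)
    assume "\<nexists>N. h (Suc N) \<le> \<delta> * \<phi> (Suc N)"
    then have less: "\<delta> * \<phi> (Suc N) < h (Suc N)" for N by (meson not_le)
    \<comment> \<open>Since \<open>\<phi> 0 = 0\<close>, the sequence \<open>u\<close> agrees with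
      \<open>h\<close> at 0 and is an admissible competitor.\<close>
    define u where "u p = 1 * h p + (- \<delta>) * \<phi> p" for p
    have "u p > 0" for p using less[of "p - 1"] h_pos[of 0] by (cases p) (auto simp: u_def phi)
    moreover have "defect b (1 + \<epsilon>) u p = 0" if "p \<ge> 1" for p
      unfolding u_def defect_linear using hh[OF that] defect_harmonic_from[OF that] by (simp add: \<phi>_def)
    moreover have "u 0 = h 0" by (simp add: u_def phi)
    ultimately have "h 1 \<le> u 1" using h by (simp add: minimal_harmonic_def)
    then show False using \<open>\<delta> > 0\<close> by (simp add: u_def phi)
  qed
  then obtain N where N: "h (Suc N) / \<phi> (Suc N) \<le> \<delta>"
    using phi_pos by (auto simp: pos_divide_le_eq)
  have "h (Suc (max N q)) / \<phi> (Suc (max N q)) \<le> \<delta>"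
    using N decseqD[OF dec, of N "max N q"] by linarith
  then have "h (Suc (max N q)) \<le> \<delta> * \<phi> (Suc (max N q))"
    using phi_pos by (simp add: pos_divide_le_eq)
  then show ?thesis unfolding \<phi>_def by (intro exI[of _ "Suc (max N q)"]) auto
qed

text \<open>Adding \<open>\<delta> * \<phi>\<close> to \<open>f\<close> secures the far endpoint: by
  \<open>minimal_ratio_small\<close> it is at least \<open>h\<close> at arbitrarily large indices,
  so the minimum principle applies up to there. Finally \<delta> tends to 0.\<close>

lemma minimal_le_supersolution:
  assumes eps: "\<epsilon> > 0" and h: "minimal_harmonic b (1 + \<epsilon>) h"
    and f: "\<And>p. p \<ge> P \<Longrightarrow> f p \<ge> 0" "h P \<le> f P"
      "\<And>p. p > P \<Longrightarrow> defect b (1 + \<epsilon>) f p \<ge> 0"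
    and "q \<ge> P"
  shows "h q \<le> f q"
proof -
  define \<phi> where "\<phi> = harmonic_from b (1 + \<epsilon>) 0 1"
  have phi_nonneg: "\<phi> p \<ge> 0" for p
  proof (cases p)
    case (Suc n)
    then show ?thesis unfolding \<phi>_def
      using harmonic_from_pos[OF eps, of 0 1 n] g_pos[of 0] by simp
  qed (simp add: \<phi>_def)
  have "h q \<le> f q + \<delta> * \<phi> q" if \<delta>: "\<delta> > 0" for \<delta>
  proof -
    obtain N where N: "N \<ge> q" "h N \<le> \<delta> * \<phi> N"
      using minimal_ratio_small[OF eps h \<delta>, of q] unfolding \<phi>_def by blast
    define k where "k p = 1 * (1 * f p + \<delta> * \<phi> p) + (-1) * h p" for p
    have "k q \<ge> 0"
    proof (rule nonneg_on_interval[OF eps, of k P N])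
      show "0 \<le> k P" using f(2) phi_nonneg[of P] \<delta> by (simp add: k_def add_increasing2)
      show "0 \<le> k N" using N f(1)[of N] \<open>q \<ge> P\<close> by (simp add: k_def)
      show "0 \<le> defect b (1 + \<epsilon>) k p" if "P < p" for p
      proof -
        have "defect b (1 + \<epsilon>) \<phi> p = 0" "defect b (1 + \<epsilon>) h p = 0"
          using that defect_harmonic_from[of p] h by (auto simp: \<phi>_def minimal_harmonic_def)
        then show ?thesis unfolding k_def defect_linear using f(3)[OF that] by simp
      qed
    qed (use N \<open>q \<ge> P\<close> in auto)
    then show ?thesis by (simp add: k_def)
  qed note le = this
  show ?thesis
  proof (rule field_le_epsilon)
    fix e :: real assume "e > 0"
    \<comment> \<open>The choice \<open>\<delta> = e / (1 + \<phi> q)\<close> makes sense even if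
      \<open>\<phi> q = 0\<close> and keeps the added term below \<open>e\<close>.\<close>
    have "h q \<le> f q + e / (1 + \<phi> q) * \<phi> q"
      using le[of "e / (1 + \<phi> q)"] \<open>e > 0\<close> phi_nonneg[of q] by simp
    also have "\<dots> \<le> f q + e"
      using \<open>e > 0\<close> phi_nonneg[of q] by (simp add: divide_simps algebra_simps)
    finally show "h q \<le> f q + e" .
  qed
qed

text \<open>A crude bound uniform in \<epsilon>, for the finitely many indices where the asymptotic
  barriers are not yet valid.\<close>

lemma minimal_le_g:
  assumes "\<epsilon> > 0" "minimal_harmonic b (1 + \<epsilon>) h" "h 0 = g 0"
  shows "h p \<le> g p"
proof (rule minimal_le_supersolution[OF assms(1,2), of 0])
  show "0 \<le> defect b (1 + \<epsilon>) g p" if "0 < p" for p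
    using that assms(1) g_pos[of p] b_pos[of p] by (simp add: defect_shift g_harmonic)
qed (use assms g_pos in \<open>auto intro: less_imp_le\<close>)

end

section \<open>Defects of powers and the barriers\<close>

text \<open>Taylor expansion, to be used at \<open>x = 1 / p\<close>; the linear terms cancel. A
  cubic error suffices, since \<open>\<zeta> \<le> 1\<close> makes it no larger than the error
  coming from \<open>b\<close>.\<close>

lemma powr_second_difference:
  fixes a :: real
  shows "(\<lambda>x. (1 + x) powr a + (1 - x) powr a - 2 - a * (a - 1) * x ^ 2) \<in> O[at_right 0](\<lambda>x. x ^ 3)"
  by real_asymp

lemma powr_second_difference_nat:
  fixes \<beta> :: real
  shows "\<exists>K. \<forall>\<^sub>F p in sequentially.
    \<bar>real (p + 1) powr \<beta> + real (p - 1) powr \<beta> - 2 * real p powr \<beta>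
      - \<beta> * (\<beta> - 1) * real p powr (\<beta> - 2)\<bar> \<le> K * real p powr (\<beta> - 3)"
proof -
  have "filterlim (\<lambda>p. 1 / real p) (at_right 0) sequentially" by real_asymp
  from landau_o.big.compose[OF powr_second_difference[of \<beta>] this] obtain K where
    K: "\<forall>\<^sub>F p in sequentially. norm ((1 + 1 / real p) powr \<beta> + (1 - 1 / real p) powr \<beta> - 2
      - \<beta> * (\<beta> - 1) * (1 / real p) ^ 2) \<le> K * norm ((1 / real p) ^ 3)"
    by (auto elim: landau_o.bigE)
  have "\<forall>\<^sub>F p in sequentially. \<bar>real (p + 1) powr \<beta> + real (p - 1) powr \<beta> - 2 * real p powr \<beta>
      - \<beta> * (\<beta> - 1) * real p powr (\<beta> - 2)\<bar> \<le> K * real p powr (\<beta> - 3)"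
    using K eventually_ge_at_top[of 1]
  proof eventually_elim
    case (elim p)
    define x where "x = real p"
    have x: "x \<ge> 1" using elim by (simp add: x_def)
    have eqs: "real (p + 1) = x * (1 + 1 / x)" "real (p - 1) = x * (1 - 1 / x)"
      using x elim by (auto simp: x_def field_simps of_nat_diff)
    have 1: "real (p + 1) powr \<beta> = x powr \<beta> * (1 + 1 / x) powr \<beta>"
      "real (p - 1) powr \<beta> = x powr \<beta> * (1 - 1 / x) powr \<beta>"
      unfolding eqs using x by (auto intro!: powr_mult)
    have 2: "x powr (\<beta> - 2) = x powr \<beta> * (1 / x) ^ 2" "x powr (\<beta> - 3) = x powr \<beta> * (1 / x) ^ 3"
      using x by (auto simp: powr_diff powr_numeral power_divide)
    have "\<bar>x powr \<beta> * ((1 + 1 / x) powr \<beta> + (1 - 1 / x) powr \<beta> - 2 - \<beta> * (\<beta> - 1) * (1 / x) ^ 2)\<bar>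
      \<le> x powr \<beta> * (K * (1 / x) ^ 3)"
      unfolding abs_mult using elim(1) x by (intro mult_mono) (auto simp: x_def)
    then show ?case unfolding 1 x_def[symmetric] 2 by (simp add: algebra_simps)
  qed
  then show ?thesis by blast
qed

text \<open>Here \<open>s\<close> is \<open>sqrt (1 - 8 * w)\<close>, so
  \<open>w = (1 - s\<^sup>2) / 8\<close>, and the range of \<open>w\<close> in the theorem becomes
  \<open>0 < s < 2\<close>.\<close>

locale critical_harmonic = positive_harmonic +
  fixes s \<zeta> :: real
  assumes s: "0 < s" "s < 2"
    and zeta: "0 < \<zeta>" "\<zeta> \<le> 1"
    and b_asymp: "(\<lambda>n. b n - (1 - (1 - s\<^sup>2) / 8 / (real n)\<^sup>2)) \<in> O(\<lambda>n. real n powr (-2 - \<zeta>))"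
begin

definition a where "a = (1 - s) / 2"

text \<open>To leading order the second difference and the potential combine into the indicial
  polynomial \<open>\<beta> * (\<beta> - 1) + 2 * \<omega>\<close>, which factors as
  \<open>\<tau> * (\<tau> - s)\<close> for \<open>\<beta> = a + \<tau>\<close>. Hence, far out,
  \<open>0 < \<tau> < s\<close> gives supersolutions and \<open>\<tau> < 0\<close>
  subsolutions.\<close>

lemma defect_powr:
  "\<exists>K. \<forall>\<^sub>F p in sequentially.
    \<bar>defect b 1 (\<lambda>p. real p powr (a + \<tau>)) p + \<tau> * (\<tau> - s) * real p powr (a + \<tau> - 2)\<bar>
      \<le> K * real p powr (a + \<tau> - 2 - \<zeta>)"
proof -
  define \<beta> where "\<beta> = a + \<tau>"
  define \<omega> where "\<omega> = (1 - s\<^sup>2) / 8"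
  have coeff: "\<tau> * (\<tau> - s) = \<beta> * (\<beta> - 1) + 2 * \<omega>"
    by (simp add: \<beta>_def a_def \<omega>_def field_simps power2_eq_square)
  obtain K where K: "\<forall>\<^sub>F p in sequentially.
    \<bar>real (p + 1) powr \<beta> + real (p - 1) powr \<beta> - 2 * real p powr \<beta>
      - \<beta> * (\<beta> - 1) * real p powr (\<beta> - 2)\<bar> \<le> K * real p powr (\<beta> - 3)"
    using powr_second_difference_nat by blast
  obtain c where c: "\<forall>\<^sub>F p in sequentially.
    norm (b p - (1 - \<omega> / (real p)\<^sup>2)) \<le> c * norm (real p powr (-2 - \<zeta>))"
    using b_asymp by (auto elim: landau_o.bigE simp: \<omega>_def)
  have "\<forall>\<^sub>F p in sequentially.
    \<bar>defect b 1 (\<lambda>p. real p powr \<beta>) p + (\<beta> * (\<beta> - 1) + 2 * \<omega>) * real p powr (\<beta> - 2)\<bar>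
      \<le> (2 * c + \<bar>K\<bar>) * real p powr (\<beta> - 2 - \<zeta>)"
    using K c eventually_ge_at_top[of 1]
  proof eventually_elim
    case (elim p)
    define x where "x = real p"
    have x: "x \<ge> 1" using elim by (simp add: x_def)
    define r where "r = b p - (1 - \<omega> / x\<^sup>2)"
    define D where "D = real (p + 1) powr \<beta> + real (p - 1) powr \<beta> - 2 * x powr \<beta>
      - \<beta> * (\<beta> - 1) * x powr (\<beta> - 2)"
    have p2: "x powr (\<beta> - 2) = x powr \<beta> / x\<^sup>2" using x by (simp add: powr_diff powr_numeral)
    have b: "b p = r + 1 - \<omega> / x\<^sup>2" by (simp add: r_def)
    have "defect b 1 (\<lambda>p. real p powr \<beta>) p + (\<beta> * (\<beta> - 1) + 2 * \<omega>) * x powr (\<beta> - 2)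
      = 2 * r * x powr \<beta> - D"
      unfolding D_def defect_def x_def[symmetric] p2 b
      by (simp add: algebra_simps add_divide_distrib diff_divide_distrib)
    moreover have "\<bar>r * x powr \<beta>\<bar> \<le> (c * x powr (-2 - \<zeta>)) * x powr \<beta>"
      unfolding abs_mult r_def x_def using elim(2) by (intro mult_mono) auto
    moreover have "x powr (-2 - \<zeta>) * x powr \<beta> = x powr (\<beta> - 2 - \<zeta>)"
      using x by (simp add: powr_add[symmetric] algebra_simps)
    moreover have "\<bar>D\<bar> \<le> \<bar>K\<bar> * x powr (\<beta> - 2 - \<zeta>)"
    proof -
      have "\<bar>D\<bar> \<le> K * x powr (\<beta> - 3)" using elim(1) by (simp add: D_def x_def)
      also have "\<dots> \<le> \<bar>K\<bar> * x powr (\<beta> - 2 - \<zeta>)"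
        using x zeta by (intro mult_mono powr_mono) auto
      finally show ?thesis .
    qed
    ultimately show ?case unfolding x_def[symmetric]
      by (simp add: algebra_simps abs_le_iff)
  qed
  then show ?thesis unfolding coeff \<beta>_def[symmetric] by blast
qed

lemma b_lower: "\<exists>\<kappa>\<ge>0. \<forall>\<^sub>F p in sequentially. b p \<ge> 1 - \<kappa> / (real p)\<^sup>2"
  and b_bounds: "\<forall>\<^sub>F p in sequentially. 1 / 2 \<le> b p \<and> b p \<le> 2"
proof -
  define \<omega> where "\<omega> = (1 - s\<^sup>2) / 8"
  obtain c where c: "\<forall>\<^sub>F p in sequentially.
    norm (b p - (1 - \<omega> / (real p)\<^sup>2)) \<le> c * norm (real p powr (-2 - \<zeta>))"
    using b_asymp by (auto elim: landau_o.bigE simp: \<omega>_def)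
  define \<kappa> where "\<kappa> = \<bar>\<omega>\<bar> + \<bar>c\<bar>"
  have ev: "\<forall>\<^sub>F p in sequentially. \<bar>b p - 1\<bar> \<le> \<kappa> / (real p)\<^sup>2"
    using c eventually_ge_at_top[of 1]
  proof eventually_elim
    case (elim p)
    have "c * real p powr (-2 - \<zeta>) \<le> \<bar>c\<bar> * real p powr (-2)"
      using elim zeta by (intro mult_mono powr_mono) auto
    also have "\<dots> = \<bar>c\<bar> / (real p)\<^sup>2" using elim by (simp add: powr_minus_divide powr_numeral)
    finally have "\<bar>b p - (1 - \<omega> / (real p)\<^sup>2)\<bar> \<le> \<bar>c\<bar> / (real p)\<^sup>2" using elim by simp
    moreover have "\<bar>\<omega> / (real p)\<^sup>2\<bar> = \<bar>\<omega>\<bar> / (real p)\<^sup>2" by simp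
    ultimately have "\<bar>b p - 1\<bar> \<le> \<bar>\<omega>\<bar> / (real p)\<^sup>2 + \<bar>c\<bar> / (real p)\<^sup>2" by linarith
    then show ?case by (simp add: \<kappa>_def add_divide_distrib)
  qed
  then have "\<forall>\<^sub>F p in sequentially. b p \<ge> 1 - \<kappa> / (real p)\<^sup>2"
    by eventually_elim (simp add: abs_le_iff)
  moreover have "\<kappa> \<ge> 0" by (simp add: \<kappa>_def)
  ultimately show "\<exists>\<kappa>\<ge>0. \<forall>\<^sub>F p in sequentially. b p \<ge> 1 - \<kappa> / (real p)\<^sup>2" by blast
  have "(\<lambda>p. \<kappa> / (real p)\<^sup>2) \<longlonglongrightarrow> 0" by real_asymp
  then have "\<forall>\<^sub>F p in sequentially. \<kappa> / (real p)\<^sup>2 < 1 / 2"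
    by (rule order_tendstoD) simp
  with ev show "\<forall>\<^sub>F p in sequentially. 1 / 2 \<le> b p \<and> b p \<le> 2"
  proof eventually_elim
    case (elim p)
    then show ?case by (intro conjI; linarith)
  qed
qed

lemma powr_small:
  fixes K q :: real
  assumes "\<eta> > 0" "q > 0"
  shows "\<forall>\<^sub>F p in sequentially. K * real p powr (-\<eta>) < q"
proof -
  have "(\<lambda>p. K * real p powr (-\<eta>)) \<longlonglongrightarrow> 0" using assms by real_asymp
  then show ?thesis by (rule order_tendstoD) fact
qed

text \<open>At \<open>\<tau> = 0\<close> the leading term vanishes, leaving an error of order
  \<open>p powr (a - 2 - \<zeta>)\<close>. The correction with \<open>\<tau> = - \<zeta> / 2\<close>
  has a negative defect of the larger order \<open>p powr (a - 2 - \<zeta> / 2)\<close>, so its sign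
  decides. The value \<open>\<tau> = s / 2\<close> maximises \<open>\<tau> * (s - \<tau>)\<close> at
  \<open>s\<^sup>2 / 4\<close>, half of which absorbs the error.\<close>

lemma barriers:
  shows "\<forall>\<^sub>F p in sequentially. defect b 1 (\<lambda>p. real p powr a - real p powr (a - \<zeta> / 2)) p \<ge> 0" (is ?A)
    and "\<forall>\<^sub>F p in sequentially. defect b 1 (\<lambda>p. real p powr a + real p powr (a - \<zeta> / 2)) p \<le> 0" (is ?B)
    and "\<forall>\<^sub>F p in sequentially. defect b 1 (\<lambda>p. real p powr (a + s / 2)) p
            \<ge> s\<^sup>2 / 8 * real p powr (a + s / 2 - 2)" (is ?C)
proof -
  define \<eta> where "\<eta> = \<zeta> / 2"
  have eta: "\<eta> > 0" using zeta by (simp add: \<eta>_def)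
  obtain K0 where K0: "\<forall>\<^sub>F p in sequentially.
    \<bar>defect b 1 (\<lambda>p. real p powr a) p\<bar> \<le> K0 * real p powr (a - 2 - \<zeta>)"
    using defect_powr[of 0] by auto
  obtain K1 where K1: "\<forall>\<^sub>F p in sequentially.
    \<bar>defect b 1 (\<lambda>p. real p powr (a - \<eta>)) p + \<eta> * (\<eta> + s) * real p powr (a - \<eta> - 2)\<bar>
      \<le> K1 * real p powr (a - \<eta> - 2 - \<zeta>)"
    using defect_powr[of "- \<eta>"] by (auto simp: algebra_simps)
  obtain K2 where K2: "\<forall>\<^sub>F p in sequentially.
    \<bar>defect b 1 (\<lambda>p. real p powr (a + s / 2)) p - s\<^sup>2 / 4 * real p powr (a + s / 2 - 2)\<bar>
      \<le> K2 * real p powr (a + s / 2 - 2 - \<zeta>)"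
    using defect_powr[of "s / 2"] by (auto simp: field_simps power2_eq_square)
  have q: "\<eta> * (\<eta> + s) > 0" using eta s by simp
  \<comment> \<open>One inequality with an absolute value serves both signs of the
    correction.\<close>
  have main: "\<forall>\<^sub>F p in sequentially.
    defect b 1 (\<lambda>p. real p powr (a - \<eta>)) p \<le> - \<bar>defect b 1 (\<lambda>p. real p powr a) p\<bar>"
    using K0 K1 powr_small[OF eta q, of "\<bar>K0\<bar> + \<bar>K1\<bar>"] eventually_ge_at_top[of 1]
  proof eventually_elim
    case (elim p)
    define x where "x = real p"
    have x: "x \<ge> 1" using elim by (simp add: x_def)
    define y where "y = x powr (a - \<eta> - 2)"
    have y: "y > 0" using x by (simp add: y_def)
    have e0: "x powr (a - 2 - \<zeta>) = y * x powr (-\<eta>)"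
      using x by (simp add: y_def powr_add[symmetric] \<eta>_def)
    have e1: "x powr (a - \<eta> - 2 - \<zeta>) \<le> y * x powr (-\<eta>)"
      using x zeta by (simp add: y_def powr_add[symmetric] \<eta>_def powr_mono)
    have k0: "K0 * x powr (a - 2 - \<zeta>) \<le> \<bar>K0\<bar> * (y * x powr (-\<eta>))"
      unfolding e0 using y x by (intro mult_right_mono) auto
    have k1: "K1 * x powr (a - \<eta> - 2 - \<zeta>) \<le> \<bar>K1\<bar> * (y * x powr (-\<eta>))"
      using e1 y x by (intro mult_mono) auto
    have "y * ((\<bar>K0\<bar> + \<bar>K1\<bar>) * x powr (-\<eta>)) \<le> y * (\<eta> * (\<eta> + s))"
      using elim(3) y by (intro mult_left_mono) (auto simp: x_def)
    then have "\<bar>K0\<bar> * (y * x powr (-\<eta>)) + \<bar>K1\<bar> * (y * x powr (-\<eta>)) \<le> \<eta> * (\<eta> + s) * y"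
      by (simp add: algebra_simps)
    moreover have "\<bar>defect b 1 (\<lambda>p. real p powr a) p\<bar> \<le> \<bar>K0\<bar> * (y * x powr (-\<eta>))"
      using elim(1) k0 by (simp add: x_def)
    moreover have "defect b 1 (\<lambda>p. real p powr (a - \<eta>)) p + \<eta> * (\<eta> + s) * y \<le> \<bar>K1\<bar> * (y * x powr (-\<eta>))"
      using elim(2) k1 by (simp add: x_def[symmetric] y_def[symmetric] abs_le_iff)
    ultimately show ?case by linarith
  qed
  have lin: "defect b 1 (\<lambda>p. real p powr a + c * real p powr (a - \<zeta> / 2)) p
    = defect b 1 (\<lambda>p. real p powr a) p + c * defect b 1 (\<lambda>p. real p powr (a - \<eta>)) p" for c p
    using defect_linear[of b 1 1 "\<lambda>p. real p powr a" c "\<lambda>p. real p powr (a - \<eta>)" p]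
    by (simp add: \<eta>_def)
  show ?A using main by eventually_elim (use lin[of "-1"] in simp)
  show ?B using main by eventually_elim (use lin[of "1"] in simp)
  have "s\<^sup>2 / 8 > 0" using s by simp
  from K2 powr_small[OF zeta(1) this, of "K2"] eventually_ge_at_top[of 1] show ?C
  proof eventually_elim
    case (elim p)
    define x where "x = real p"
    have x: "x \<ge> 1" using elim by (simp add: x_def)
    define y where "y = x powr (a + s / 2 - 2)"
    have y: "y > 0" using x by (simp add: y_def)
    have e: "x powr (a + s / 2 - 2 - \<zeta>) = y * x powr (-\<zeta>)"
      using x by (simp add: y_def powr_add[symmetric])
    have "y * (K2 * x powr (-\<zeta>)) \<le> y * (s\<^sup>2 / 8)"
      using elim(2) y by (intro mult_left_mono) (auto simp: x_def)
    then have "K2 * (y * x powr (-\<zeta>)) \<le> y * (s\<^sup>2 / 8)" by (simp add: algebra_simps)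
    with elim(1) show ?case
      unfolding x_def[symmetric] e unfolding y_def[symmetric] abs_le_iff by (simp add: algebra_simps)
  qed
qed

end

section \<open>Pointwise bounds for the minimal solution, uniform in \<epsilon>\<close>

context critical_harmonic begin

text \<open>From \<open>N\<close> on, a multiple of the supersolution \<open>f\<close> that equals
  \<open>g\<close> at \<open>N\<close> dominates \<open>h\<close>; below \<open>N\<close> the bound
  by \<open>g\<close> is enough. Both constants are independent of \<epsilon> and
  \<open>h\<close>.\<close>

lemma minimal_le_powr:
  "\<exists>C\<ge>0. \<forall>\<epsilon>>0. \<forall>h. minimal_harmonic b (1 + \<epsilon>) h \<longrightarrow> h 0 = g 0 \<longrightarrow> (\<forall>p\<ge>1. h p \<le> C * real p powr a)"
proof -
  \<comment> \<open>The bound 1/2 keeps the factor \<open>1 - real p powr (- (\<zeta> / 2))\<close>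
    of the barrier positive.\<close>
  have "\<forall>\<^sub>F p in sequentially. defect b 1 (\<lambda>p. real p powr a - real p powr (a - \<zeta> / 2)) p \<ge> 0
      \<and> real p powr (- (\<zeta> / 2)) < 1 / 2 \<and> p \<ge> 1"
    using barriers(1) powr_small[of "\<zeta> / 2" "1 / 2" 1] eventually_ge_at_top[of "1::nat"] zeta(1)
    by (auto simp: eventually_conj_iff)
  then obtain N where N: "\<And>p. p \<ge> N \<Longrightarrow> defect b 1 (\<lambda>p. real p powr a - real p powr (a - \<zeta> / 2)) p \<ge> 0"
    "\<And>p. p \<ge> N \<Longrightarrow> real p powr (- (\<zeta> / 2)) < 1 / 2" "\<And>p. p \<ge> N \<Longrightarrow> p \<ge> 1"
    unfolding eventually_sequentially by blast
  define f where "f p = real p powr a - real p powr (a - \<zeta> / 2)" for p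
  have f_eq: "f p = real p powr a * (1 - real p powr (- (\<zeta> / 2)))" for p
    by (simp add: f_def right_diff_distrib powr_add[symmetric])
  have f: "f p > 0" "f p \<le> real p powr a" if "p \<ge> N" for p
    unfolding f_eq using N(2,3)[OF that] by (auto simp: mult_le_cancel_left1)
  define C1 where "C1 = g N / f N"
  \<comment> \<open>The sum bounds each of its nonnegative terms; the term at 0 is 0, because
    \<open>0 powr a = 0\<close> and division by 0 gives 0.\<close>
  define C2 where "C2 = (\<Sum>p<N. g p / real p powr a)"
  have C1: "C1 > 0" using f(1)[of N] g_pos by (simp add: C1_def)
  have C2: "C2 \<ge> 0" using g_pos by (auto simp: C2_def intro!: sum_nonneg divide_nonneg_nonneg intro: less_imp_le)
  have "h p \<le> (C1 + C2) * real p powr a"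
    if eps: "\<epsilon> > 0" and h: "minimal_harmonic b (1 + \<epsilon>) h" "h 0 = g 0" and p: "p \<ge> 1" for \<epsilon> h p
  proof (cases "p < N")
    case True
    have "h p \<le> g p" by (rule minimal_le_g[OF eps h])
    also have "\<dots> = g p / real p powr a * real p powr a" using p by simp
    also have "g p / real p powr a \<le> C2"
      unfolding C2_def using True g_pos
      by (intro member_le_sum) (auto intro!: divide_nonneg_nonneg intro: less_imp_le)
    also have "\<dots> \<le> C1 + C2" using C1 by simp
    finally show ?thesis by (simp add: mult_right_mono)
  next
    case False
    then have p: "p \<ge> N" by simp
    have "h p \<le> C1 * f p"
    proof (rule minimal_le_supersolution[OF eps h(1), of N "\<lambda>p. C1 * f p"])
      show "0 \<le> C1 * f p" if "p \<ge> N" for p using C1 f(1)[OF that] by simp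
      show "h N \<le> C1 * f N"
        using minimal_le_g[OF eps h, of N] f(1)[of N] by (simp add: C1_def)
      show "0 \<le> defect b (1 + \<epsilon>) (\<lambda>p. C1 * f p) p" if "p > N" for p
        unfolding defect_scale
        using that N(1)[of p] N(3)[of p] C1 f(1)[of p] b_pos[of p] eps
        by (simp add: defect_shift f_def[symmetric])
    qed (rule p)
    also have "\<dots> \<le> (C1 + C2) * real p powr a"
      using f[OF p] C1 C2 by (auto intro!: mult_mono)
    finally show ?thesis .
  qed
  with C1 C2 show ?thesis by (intro exI[of _ "C1 + C2"]) auto
qed

text \<open>Beyond the scale \<open>\<epsilon> powr (-1/2)\<close> the term \<open>2 * \<epsilon> * b p\<close> beats the inverse square
  potential, which makes \<open>1 / p\<close> a supersolution; its square is summable, which is all the decay needed.\<close>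
lemma minimal_tail:
  "\<exists>M\<ge>1. \<forall>\<epsilon>>0. \<epsilon> \<le> 1 \<longrightarrow> (\<forall>h P p. minimal_harmonic b (1 + \<epsilon>) h \<longrightarrow> real P \<ge> M / sqrt \<epsilon> \<longrightarrow> p \<ge> P
      \<longrightarrow> h p \<le> h P * real P / real p)"
proof -
  obtain \<kappa> where kap: "\<kappa> \<ge> 0" "\<forall>\<^sub>F p in sequentially. b p \<ge> 1 - \<kappa> / (real p)\<^sup>2" using b_lower by blast
  then obtain N where N: "\<And>p. p \<ge> N \<Longrightarrow> b p \<ge> 1 - \<kappa> / (real p)\<^sup>2"
    unfolding eventually_sequentially by blast
  \<comment> \<open>\<open>M \<ge> N\<close> brings every \<open>p > P\<close> into the range of the
    bound on \<open>b\<close>; the rest turns \<open>M * M \<le> \<epsilon> * x\<^sup>2\<close> into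
    \<open>2 * \<kappa> + 2 \<le> \<epsilon> * x\<^sup>2\<close>.\<close>
  define M where "M = real N + 2 * \<kappa> + 2"
  have M: "M \<ge> 1" "M \<ge> N" "M \<ge> 2" "M \<ge> 2 * \<kappa> + 2" using kap by (simp_all add: M_def)
  have "h p \<le> h P * real P / real p"
    if eps: "\<epsilon> > 0" "\<epsilon> \<le> 1" and h: "minimal_harmonic b (1 + \<epsilon>) h" and P: "real P \<ge> M / sqrt \<epsilon>"
      and "p \<ge> P" for \<epsilon> h P p
  proof -
    define c where "c = h P * real P"
    have "M * 1 \<le> M / sqrt \<epsilon>" using eps M by (simp add: pos_le_divide_eq mult_left_le)
    then have PM: "real P \<ge> M" using P by simp
    have c: "c > 0" using h PM M by (auto simp: c_def minimal_harmonic_def)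
    have "h p \<le> c / real p"
    proof (rule minimal_le_supersolution[OF eps(1) h, of P "\<lambda>p. c / real p"])
      show "0 \<le> c / real p" for p using c by simp
      show "h P \<le> c / real P" using PM M by (simp add: c_def)
      show "0 \<le> defect b (1 + \<epsilon>) (\<lambda>p. c / real p) p" if "P < p" for p
      proof -
        define x where "x = real p"
        have x: "x > real P" "x \<ge> 2" using that PM M by (auto simp: x_def)
        have "M \<le> x * sqrt \<epsilon>" using P x eps by (simp add: pos_divide_le_eq) (smt (verit) mult_right_mono real_sqrt_gt_zero)
        then have "M * M \<le> (x * sqrt \<epsilon>) * (x * sqrt \<epsilon>)" using M by (intro mult_mono) auto
        then have "M * M \<le> \<epsilon> * x\<^sup>2" using eps by (simp add: power2_eq_square algebra_simps)
        moreover have "M * 1 \<le> M * M" using M by (intro mult_left_mono) auto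
        ultimately have big: "2 * \<kappa> + 2 \<le> \<epsilon> * x\<^sup>2" using M by linarith
        have bx: "b p \<ge> 1 - \<kappa> / x\<^sup>2" using N[of p] that PM M by (simp add: x_def)
        \<comment> \<open>One \<kappa> pays for the potential, the other for the mixed term
          \<open>\<epsilon> * (\<kappa> / x\<^sup>2)\<close>, and the 2 for the convexity of
          \<open>1 / x\<close>.\<close>
        have "1 + 2 / x\<^sup>2 \<le> 1 + \<epsilon> - 2 * \<kappa> / x\<^sup>2"
          using big x by (simp add: divide_simps) (simp add: algebra_simps)
        also have "\<dots> \<le> (1 + \<epsilon>) * (1 - \<kappa> / x\<^sup>2)"
        proof -
          have "\<epsilon> * (\<kappa> / x\<^sup>2) \<le> 1 * (\<kappa> / x\<^sup>2)" using eps kap x by (intro mult_right_mono) auto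
          then show ?thesis by (simp add: algebra_simps add_divide_distrib)
        qed
        also have "\<dots> \<le> (1 + \<epsilon>) * b p" using bx eps by (intro mult_left_mono) auto
        finally have *: "1 + 2 / x\<^sup>2 \<le> (1 + \<epsilon>) * b p" .
        have xx: "x * x \<ge> 2 * 2" using x by (intro mult_mono) auto
        then have "x * x \<noteq> 1" by auto
        then have "1 / (x + 1) + 1 / (x - 1) = 2 * x / (x\<^sup>2 - 1)"
          using x by (simp add: divide_simps power2_eq_square) (simp add: algebra_simps)
        \<comment> \<open>Clearing denominators reduces this to
          \<open>x\<^sup>2 \<ge> 2\<close>.\<close>
        also have "\<dots> \<le> 2 * (1 + 2 / x\<^sup>2) / x"
          using x xx by (simp add: divide_simps power2_eq_square) (simp add: algebra_simps)
        also have "\<dots> \<le> 2 * ((1 + \<epsilon>) * b p) / x" using * x by (intro divide_right_mono mult_left_mono) auto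
        finally have "c * (1 / (x + 1) + 1 / (x - 1)) \<le> c * (2 * ((1 + \<epsilon>) * b p) / x)"
          using c by (intro mult_left_mono) auto
        moreover have x1: "real (p - 1) = x - 1" "real (p + 1) = x + 1"
          using that by (simp_all add: x_def of_nat_diff)
        ultimately show ?thesis
          unfolding defect_def x1 x_def[symmetric] by (simp add: algebra_simps add_divide_distrib)
      qed
    qed fact
    then show ?thesis by (simp add: c_def)
  qed
  with M show ?thesis by (intro exI[of _ M]) auto
qed

text \<open>Supplies the constant that matches the lower barrier at its left end. Since the next
  value is positive, \<open>h n \<le> 2 * (1 + \<epsilon>) * b (Suc n) * h (Suc n)\<close>, and
  \<open>\<epsilon> \<le> 1\<close> makes the loss uniform.\<close>

lemma minimal_lower_at:
  "\<exists>c>0. \<forall>\<epsilon>>0. \<epsilon> \<le> 1 \<longrightarrow> (\<forall>h. minimal_harmonic b (1 + \<epsilon>) h \<longrightarrow> h 0 = g 0 \<longrightarrow> c \<le> h n)"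
proof (induction n)
  case 0
  then show ?case using g_pos by (intro exI[of _ "g 0"]) auto
next
  case (Suc n)
  then obtain c where c: "c > 0"
    "\<And>\<epsilon> h. \<epsilon> > 0 \<Longrightarrow> \<epsilon> \<le> 1 \<Longrightarrow> minimal_harmonic b (1 + \<epsilon>) h \<Longrightarrow> h 0 = g 0 \<Longrightarrow> c \<le> h n" by blast
  have bn: "b (Suc n) > 0" by (simp add: b_pos)
  have "c / (4 * b (Suc n)) \<le> h (Suc n)"
    if eps: "\<epsilon> > 0" "\<epsilon> \<le> 1" and h: "minimal_harmonic b (1 + \<epsilon>) h" "h 0 = g 0" for \<epsilon> h
  proof -
    have "defect b (1 + \<epsilon>) h (Suc n) = 0" "h (Suc (Suc n)) > 0" "h (Suc n) > 0"
      using h by (auto simp: minimal_harmonic_def)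
    then have "2 * (1 + \<epsilon>) * (b (Suc n) * h (Suc n)) \<ge> c"
      using c(2)[OF eps h] by (simp add: defect_def algebra_simps)
    moreover have "2 * (1 + \<epsilon>) * (b (Suc n) * h (Suc n)) \<le> 4 * (b (Suc n) * h (Suc n))"
      using eps bn \<open>h (Suc n) > 0\<close> by (intro mult_right_mono) auto
    ultimately have "c \<le> 4 * (b (Suc n) * h (Suc n))" by (rule order_trans)
    then have "c \<le> h (Suc n) * (4 * b (Suc n))" by (simp add: mult_ac)
    then show ?thesis using bn by (simp add: pos_divide_le_eq)
  qed
  then show ?case using c bn by (intro exI[of _ "c / (4 * b (Suc n))"]) auto
qed

text \<open>The subsolution is \<open>p powr a + p powr (a - \<zeta> / 2) - 2 * Q powr (- s / 2) * p powr (a + s / 2)\<close>.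
  Its last summand, an exponent halfway between the two characteristic ones, contributes a defect
  that pays for the term \<open>2 * \<epsilon> * b p\<close> when \<open>p \<le> Q\<close> and \<open>32 * \<epsilon> * Q\<^sup>2 = s\<^sup>2\<close>, and it makes the
  barrier negative from \<open>Q\<close> on.\<close>
lemma minimal_ge_powr:
  "\<exists>k>0. \<exists>\<delta>>0. \<exists>N. \<forall>\<epsilon>>0. \<epsilon> \<le> 1 \<longrightarrow> (\<forall>h. minimal_harmonic b (1 + \<epsilon>) h \<longrightarrow> h 0 = g 0 \<longrightarrow>
     (\<forall>p\<ge>N. real p \<le> \<delta> / sqrt \<epsilon> \<longrightarrow> k * real p powr a \<le> h p))"
proof -
  define \<sigma> where "\<sigma> = s / 2"
  have sig: "\<sigma> > 0" "\<sigma> < 1" using s by (auto simp: \<sigma>_def)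
  have "\<forall>\<^sub>F p in sequentially. defect b 1 (\<lambda>p. real p powr a + real p powr (a - \<zeta> / 2)) p \<le> 0
      \<and> defect b 1 (\<lambda>p. real p powr (a + \<sigma>)) p \<ge> s\<^sup>2 / 8 * real p powr (a + \<sigma> - 2)
      \<and> b p \<le> 2 \<and> p \<ge> 1"
    using barriers(2,3) b_bounds eventually_ge_at_top[of "1::nat"]
    by (auto simp: eventually_conj_iff \<sigma>_def)
  then obtain N where N: "\<And>p. p \<ge> N \<Longrightarrow> defect b 1 (\<lambda>p. real p powr a + real p powr (a - \<zeta> / 2)) p \<le> 0"
    "\<And>p. p \<ge> N \<Longrightarrow> defect b 1 (\<lambda>p. real p powr (a + \<sigma>)) p \<ge> s\<^sup>2 / 8 * real p powr (a + \<sigma> - 2)"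
    "\<And>p. p \<ge> N \<Longrightarrow> b p \<le> 2" "\<And>p. p \<ge> N \<Longrightarrow> p \<ge> 1"
    unfolding eventually_sequentially by blast
  obtain c where c: "c > 0"
    "\<And>\<epsilon> h. \<epsilon> > 0 \<Longrightarrow> \<epsilon> \<le> 1 \<Longrightarrow> minimal_harmonic b (1 + \<epsilon>) h \<Longrightarrow> h 0 = g 0 \<Longrightarrow> c \<le> h N"
    using minimal_lower_at[of N] by blast
  \<comment> \<open>The barrier is at most \<open>2 * real N powr a\<close> at \<open>N\<close>, so
    \<open>k\<close> times it is at most \<open>c\<close>.\<close>
  define k where "k = c / (2 * real N powr a)"
  have N1: "real N \<ge> 1" using N(4)[of N] by simp
  have k: "k > 0" using c(1) N1 by (simp add: k_def)
  \<comment> \<open>With \<open>q powr \<sigma> = 1 / 4\<close>, the subtracted part of the barrier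
    is at most half of \<open>real p powr a\<close> for \<open>p \<le> q * Q\<close>.\<close>
  define q where "q = (1 / 4) powr (1 / \<sigma>)"
  have q: "q > 0" "q powr \<sigma> = 1 / 4" using sig by (auto simp: q_def powr_powr)
  have "q < 1" using sig by (simp add: q_def powr01_less_one)
  define \<delta> where "\<delta> = q * (s / sqrt 32)"
  have del: "\<delta> > 0" using q s by (simp add: \<delta>_def)
  have "k / 2 * real p powr a \<le> h p"
    if eps: "\<epsilon> > 0" "\<epsilon> \<le> 1" and h: "minimal_harmonic b (1 + \<epsilon>) h" "h 0 = g 0"
      and p: "p \<ge> N" "real p \<le> \<delta> / sqrt \<epsilon>" for \<epsilon> h p
  proof -
    define Q where "Q = s / sqrt 32 / sqrt \<epsilon>"
    have Q: "Q > 0" using s eps by (simp add: Q_def)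
    have Q2: "s\<^sup>2 = 32 * \<epsilon> * Q\<^sup>2" using eps by (simp add: Q_def power_divide power_mult_distrib)
    have pQ: "real p \<le> q * Q" using p by (simp add: \<delta>_def Q_def)
    \<comment> \<open>Rounding \<open>Q\<close> up makes the barrier nonpositive at
      \<open>L\<close>, while indices strictly between \<open>N\<close> and \<open>L\<close> are
      still at most \<open>Q\<close>.\<close>
    define L where "L = max N (nat \<lceil>Q\<rceil>)"
    have L: "L \<ge> N" "real L \<ge> Q" "\<And>j. N < j \<Longrightarrow> j < L \<Longrightarrow> real j \<le> Q"
    proof -
      show "L \<ge> N" by (simp add: L_def)
      show "real L \<ge> Q" unfolding L_def by linarith
      show "real j \<le> Q" if "N < j" "j < L" for j using that unfolding L_def by linarith
    qed
    define f where "f j = real j powr a + real j powr (a - \<zeta> / 2)" for j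
    define v where "v j = 1 * f j + (- 2 * Q powr (-\<sigma>)) * real j powr (a + \<sigma>)" for j
    have v_eq: "v j = f j - 2 * (real j / Q) powr \<sigma> * real j powr a" for j
      using Q by (simp add: v_def powr_divide powr_minus_divide powr_add)
    have f_le: "f j \<le> 2 * real j powr a" if "j \<ge> N" for j
      using N(4)[OF that] zeta by (simp add: f_def powr_mono)
    have v_defect: "defect b (1 + \<epsilon>) v j \<le> 0" if j: "N < j" "j < L" for j
    proof -
      define x where "x = real j"
      have x: "x \<ge> 1" "x \<le> Q" using N(4)[of j] L(3)[of j] j by (auto simp: x_def)
      define y where "y = Q powr (-\<sigma>) * x powr (a + \<sigma> - 2)"
      have "Q powr (-\<sigma>) * (s\<^sup>2 / 8 * x powr (a + \<sigma> - 2))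
        \<le> Q powr (-\<sigma>) * defect b 1 (\<lambda>p. real p powr (a + \<sigma>)) j"
        using N(2)[of j] j by (intro mult_left_mono) (auto simp: x_def)
      then have "defect b 1 v j \<le> - 2 * (s\<^sup>2 / 8) * y"
        unfolding v_def defect_linear using N(1)[of j] j
        by (simp add: f_def[abs_def] y_def algebra_simps)
      also have "y \<ge> Q powr (-2) * x powr a"
      proof -
        \<comment> \<open>The exponent \<open>\<sigma> - 2\<close> is negative and
          \<open>x \<le> Q\<close>, so replacing \<open>Q\<close> by \<open>x\<close> in that factor
          increases it.\<close>
        have "Q powr (-2) = Q powr (-\<sigma>) * Q powr (\<sigma> - 2)" by (simp add: powr_add[symmetric])
        also have "\<dots> \<le> Q powr (-\<sigma>) * x powr (\<sigma> - 2)"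
          using x sig by (intro mult_left_mono powr_mono2') auto
        finally have "Q powr (-2) * x powr a \<le> Q powr (-\<sigma>) * x powr (\<sigma> - 2) * x powr a"
          by (intro mult_right_mono) auto
        also have "\<dots> = y" by (simp add: y_def powr_add[symmetric] algebra_simps)
        finally show ?thesis .
      qed
      then have "- 2 * (s\<^sup>2 / 8) * y \<le> - 2 * (s\<^sup>2 / 8) * (Q powr (-2) * x powr a)"
        by (intro mult_left_mono_neg) auto
      \<comment> \<open>The factor 8 is exactly what bounds
        \<open>2 * \<epsilon> * b j * v j\<close> when \<open>b j \<le> 2\<close> and
        \<open>v j \<le> 2 * x powr a\<close>.\<close>
      also have "\<dots> = - 8 * \<epsilon> * x powr a"
        using Q by (simp add: Q2 powr_minus_divide powr_numeral)
      finally have 1: "defect b 1 v j \<le> - 8 * \<epsilon> * x powr a" .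
      have "v j \<le> 2 * x powr a" using f_le[of j] j by (simp add: v_eq x_def) (smt (verit) mult_nonneg_nonneg powr_ge_zero)
      then have "2 * \<epsilon> * b j * v j \<le> 2 * \<epsilon> * b j * (2 * x powr a)"
        using eps b_pos[of j] j by (intro mult_left_mono) auto
      also have "\<dots> \<le> 2 * \<epsilon> * 2 * (2 * x powr a)"
        using eps N(3)[of j] j by (intro mult_right_mono mult_left_mono) auto
      finally show ?thesis using 1 by (simp add: defect_shift)
    qed
    define d where "d j = 1 * h j + (- k) * v j" for j
    have h_pos: "h j > 0" for j using h by (simp add: minimal_harmonic_def)
    have "d p \<ge> 0"
    proof (rule nonneg_on_interval[OF eps(1), of d N L])
      have "v N \<le> 2 * real N powr a"
        using f_le[of N] Q by (simp add: v_eq) (smt (verit) mult_nonneg_nonneg powr_ge_zero)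
      then have "k * v N \<le> k * (2 * real N powr a)" using k by (intro mult_left_mono) auto
      also have "\<dots> = c" using N1 by (simp add: k_def)
      also have "\<dots> \<le> h N" by (rule c(2)[OF eps h])
      finally show "0 \<le> d N" by (simp add: d_def)
      have "(real L / Q) powr \<sigma> \<ge> 1" using L(2) Q sig by (intro ge_one_powr_ge_zero) auto
      then have "1 * real L powr a \<le> (real L / Q) powr \<sigma> * real L powr a" by (intro mult_right_mono) auto
      then have "v L \<le> 0" using f_le[OF L(1)] by (simp add: v_eq)
      then have "k * v L \<le> 0" using k by (simp add: mult_nonneg_nonpos)
      then show "0 \<le> d L" using h_pos[of L] by (simp add: d_def)
      show "0 \<le> defect b (1 + \<epsilon>) d j" if "N < j" "j < L" for j
      proof -
        have "defect b (1 + \<epsilon>) h j = 0" using h that by (auto simp: minimal_harmonic_def)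
        moreover have "k * defect b (1 + \<epsilon>) v j \<le> 0"
          using v_defect[OF that] k by (simp add: mult_nonneg_nonpos)
        ultimately show ?thesis unfolding d_def defect_linear by simp
      qed
      show "N \<le> p" by fact
      have "q * Q \<le> 1 * Q" using \<open>q < 1\<close> Q by (intro mult_right_mono) auto
      then show "p \<le> L" using pQ L(2) by simp
    qed
    then have "k * v p \<le> h p" by (simp add: d_def)
    moreover have "v p \<ge> real p powr a / 2"
    proof -
      have "(real p / Q) powr \<sigma> \<le> q powr \<sigma>"
        using pQ Q sig q by (intro powr_mono2) (auto simp: divide_simps)
      then have "(real p / Q) powr \<sigma> * real p powr a \<le> 1 / 4 * real p powr a"
        unfolding q by (intro mult_right_mono) auto
      moreover have "f p \<ge> real p powr a" by (simp add: f_def)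
      ultimately show ?thesis by (simp add: v_eq)
    qed
    ultimately show ?thesis using k by (smt (verit) mult_left_mono times_divide_eq_left times_divide_eq_right)
  qed
  then show ?thesis using k del
    by (intro exI[of _ "k / 2"] conjI exI[of _ \<delta>] exI[of _ N]) auto
qed

end

section \<open>Sums of squares of the minimal solution\<close>

text \<open>Comparison with an integral, by the mean value theorem. The factor 2 covers the change
  from \<open>z\<close> to \<open>n + 1\<close>: since \<open>n + 1 \<le> 2 * z\<close>, it costs at
  most \<open>2 powr (\<gamma> - 1) \<le> 2\<close> for \<open>\<gamma> \<ge> 1\<close> and nothing
  otherwise.\<close>

lemma sum_powr_le:
  fixes \<gamma> :: real
  assumes "0 < \<gamma>" "\<gamma> < 2"
  shows "(\<Sum>p=1..n. real p powr (\<gamma> - 1)) \<le> 2 / \<gamma> * real n powr \<gamma>"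
proof (induction n)
  case (Suc n)
  have "real n powr \<gamma> + \<gamma> / 2 * real (Suc n) powr (\<gamma> - 1) \<le> real (Suc n) powr \<gamma>"
  proof (cases "n = 0")
    case True
    then show ?thesis using assms by simp
  next
    case False
    have "\<exists>z>real n. z < real n + 1 \<and> (real n + 1) powr \<gamma> - real n powr \<gamma> = (real n + 1 - real n) * (\<gamma> * z powr (\<gamma> - 1))"
      using False by (intro MVT2) (auto intro!: derivative_eq_intros)
    then obtain z where z: "z > real n" "z < real n + 1"
      "(real n + 1) powr \<gamma> - real n powr \<gamma> = \<gamma> * z powr (\<gamma> - 1)" by auto
    have "z powr (\<gamma> - 1) \<ge> (real n + 1) powr (\<gamma> - 1) / 2"
    proof (cases "\<gamma> \<ge> 1")
      case True
      have "(real n + 1) powr (\<gamma> - 1) \<le> (2 * z) powr (\<gamma> - 1)"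
        using True z False by (intro powr_mono2) auto
      also have "\<dots> = 2 powr (\<gamma> - 1) * z powr (\<gamma> - 1)" using z by (simp add: powr_mult)
      also have "\<dots> \<le> 2 powr 1 * z powr (\<gamma> - 1)"
        using assms by (intro mult_right_mono powr_mono) auto
      finally show ?thesis by simp
    next
      case False
      then have "(real n + 1) powr (\<gamma> - 1) \<le> z powr (\<gamma> - 1)"
        using z \<open>n \<noteq> 0\<close> by (intro powr_mono2') auto
      then show ?thesis using powr_ge_zero[of z "\<gamma> - 1"] by linarith
    qed
    then have "\<gamma> * ((real n + 1) powr (\<gamma> - 1) / 2) \<le> \<gamma> * z powr (\<gamma> - 1)"
      using assms by (intro mult_left_mono) auto
    then show ?thesis using z(3) by (simp add: add.commute)
  qed
  then have "2 / \<gamma> * (real n powr \<gamma> + \<gamma> / 2 * real (Suc n) powr (\<gamma> - 1)) \<le> 2 / \<gamma> * real (Suc n) powr \<gamma>"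
    using assms by (intro mult_left_mono) auto
  then show ?case using Suc assms by (simp add: algebra_simps)
qed simp

lemma inverse_sqrt_powr:
  fixes x \<epsilon> \<gamma> :: real
  assumes "x \<ge> 0" "\<epsilon> > 0"
  shows "(x / sqrt \<epsilon>) powr \<gamma> = x powr \<gamma> * \<epsilon> powr (- (\<gamma> / 2))"
  using assms by (simp add: powr_divide powr_half_sqrt[symmetric] powr_powr powr_minus_divide)

context critical_harmonic begin

text \<open>The sum is split at \<open>P\<close>, of order \<open>1 / sqrt \<epsilon>\<close>.
  Below, the power bound sums to order \<open>P powr \<gamma>\<close>; beyond, the decay like
  \<open>1 / p\<close> contributes no more than that order.\<close>

lemma minimal_square_sum_upper:
  "\<exists>C\<ge>0. \<forall>\<epsilon>>0. \<epsilon> \<le> 1 \<longrightarrow> (\<forall>h. minimal_harmonic b (1 + \<epsilon>) h \<longrightarrow> h 0 = g 0 \<longrightarrow>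
     (\<forall>n. (\<Sum>p=1..n. b p * (h p)\<^sup>2) \<le> C * \<epsilon> powr (- (1 - s / 2))))"
proof -
  define \<gamma> where "\<gamma> = 2 - s"
  have gam: "0 < \<gamma>" "\<gamma> < 2" using s by (auto simp: \<gamma>_def)
  \<comment> \<open>Indeed \<open>2 * a = 1 - s = \<gamma> - 1\<close>; the target exponent
    \<open>1 - s / 2\<close> is \<open>\<gamma> / 2\<close>.\<close>
  have a2: "(x powr a)\<^sup>2 = x powr (\<gamma> - 1)" for x :: real
    by (simp add: a_def \<gamma>_def power2_eq_square powr_add[symmetric])
  obtain C where C: "C \<ge> 0" "\<And>\<epsilon> h p. \<epsilon> > 0 \<Longrightarrow> minimal_harmonic b (1 + \<epsilon>) h \<Longrightarrow> h 0 = g 0 \<Longrightarrow> p \<ge> 1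
      \<Longrightarrow> h p \<le> C * real p powr a" using minimal_le_powr by blast
  obtain M where M: "M \<ge> 1" "\<And>\<epsilon> h P p. \<epsilon> > 0 \<Longrightarrow> \<epsilon> \<le> 1 \<Longrightarrow> minimal_harmonic b (1 + \<epsilon>) h \<Longrightarrow>
      real P \<ge> M / sqrt \<epsilon> \<Longrightarrow> p \<ge> P \<Longrightarrow> h p \<le> h P * real P / real p" using minimal_tail by blast
  obtain N where N: "\<And>p. p \<ge> N \<Longrightarrow> b p \<le> 2"
    using b_bounds unfolding eventually_sequentially by blast
  define B where "B = 2 + (\<Sum>p<N. \<bar>b p\<bar>)"
  have B0: "B \<ge> 0" unfolding B_def by (intro add_nonneg_nonneg sum_nonneg) auto
  have B: "b p \<le> B" for p
  proof (cases "p < N")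
    case True
    then have "\<bar>b p\<bar> \<le> (\<Sum>p<N. \<bar>b p\<bar>)" by (intro member_le_sum) auto
    then show ?thesis by (simp add: B_def)
  next
    case False
    moreover have "(\<Sum>p<N. \<bar>b p\<bar>) \<ge> 0" by (intro sum_nonneg) auto
    ultimately show ?thesis using N[of p] unfolding B_def by linarith
  qed
  have "(\<Sum>p=1..n. b p * (h p)\<^sup>2) \<le> B * (C\<^sup>2 * ((2 / \<gamma> + 1) * ((2 * M) powr \<gamma>))) * \<epsilon> powr (- (1 - s / 2))"
    if eps: "\<epsilon> > 0" "\<epsilon> \<le> 1" and h: "minimal_harmonic b (1 + \<epsilon>) h" "h 0 = g 0" for \<epsilon> h n
  proof -
    have h_pos: "h j > 0" for j using h by (simp add: minimal_harmonic_def)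
    define P where "P = nat \<lceil>M / sqrt \<epsilon>\<rceil>"
    have "M * 1 \<le> M / sqrt \<epsilon>" using eps M by (simp add: pos_le_divide_eq mult_left_le)
    then have Q1: "M / sqrt \<epsilon> \<ge> 1" using M by linarith
    \<comment> \<open>Rounding up at most doubles a number that is at least 1.\<close>
    then have P: "real P \<ge> M / sqrt \<epsilon>" "real P \<le> 2 * M / sqrt \<epsilon>" unfolding P_def by linarith+
    have P1: "real P \<ge> 1" using Q1 P by linarith
    define T where "T = real P powr \<gamma>"
    have T: "T \<ge> 0" by (simp add: T_def)
    have sq: "(h p)\<^sup>2 \<le> C\<^sup>2 * real p powr (\<gamma> - 1)" if "p \<ge> 1" for p
    proof -
      have "(h p)\<^sup>2 \<le> (C * real p powr a)\<^sup>2"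
        using C(2)[OF eps(1) h that] h_pos[of p] by (intro power_mono) auto
      then show ?thesis by (simp add: power_mult_distrib a2)
    qed
    have head: "(\<Sum>p=1..n. (h p)\<^sup>2) \<le> C\<^sup>2 * (2 / \<gamma> * real n powr \<gamma>)" for n
    proof -
      have "(\<Sum>p=1..n. (h p)\<^sup>2) \<le> (\<Sum>p=1..n. C\<^sup>2 * real p powr (\<gamma> - 1))"
        by (intro sum_mono sq) auto
      also have "\<dots> \<le> C\<^sup>2 * (2 / \<gamma> * real n powr \<gamma>)"
        unfolding sum_distrib_left[symmetric] by (intro mult_left_mono sum_powr_le gam) auto
      finally show ?thesis .
    qed
    \<comment> \<open>The subtracted term makes the bound inductive through
      \<open>1 / (n + 1)\<^sup>2 \<le> 1 / n - 1 / (n + 1)\<close>; at \<open>n = P\<close> it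
      equals \<open>T\<close> and leaves the bound of \<open>head\<close>.\<close>
    have tail: "(\<Sum>p=1..n. (h p)\<^sup>2) \<le> C\<^sup>2 * ((2 / \<gamma> + 1) * T - T * real P / real n)" if "n \<ge> P" for n
      using that
    proof (induction n rule: nat_induct_at_least)
      case base
      have "real P \<noteq> 0" using P1 by linarith
      then show ?case using head[of P] by (simp add: T_def algebra_simps)
    next
      case (Suc n)
      have n: "real n \<ge> 1" using Suc(1) P1 by linarith
      have "h (Suc n) \<le> h P * real P / real (Suc n)"
        using M(2)[OF eps h(1) P(1), of "Suc n"] Suc(1) by simp
      then have "(h (Suc n))\<^sup>2 \<le> (h P * real P / real (Suc n))\<^sup>2"
        using h_pos[of "Suc n"] by (intro power_mono) auto
      also have "\<dots> = (h P)\<^sup>2 * (real P)\<^sup>2 * (1 / (real (Suc n))\<^sup>2)"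
        by (simp add: power_divide power_mult_distrib)
      also have "\<dots> \<le> (C\<^sup>2 * real P powr (\<gamma> - 1)) * (real P)\<^sup>2 * (1 / real n - 1 / real (Suc n))"
      proof (intro mult_mono sq)
        have "1 / (real (Suc n))\<^sup>2 \<le> 1 / (real n * real (Suc n))"
          using n by (intro divide_left_mono) (auto simp: power2_eq_square)
        also have "\<dots> = 1 / real n - 1 / real (Suc n)" using n by (simp add: field_simps)
        finally show "1 / (real (Suc n))\<^sup>2 \<le> 1 / real n - 1 / real (Suc n)" .
      qed (use P1 in auto)
      also have "\<dots> = C\<^sup>2 * (T * real P / real n - T * real P / real (Suc n))"
      proof -
        have "real P powr (\<gamma> - 1) * (real P)\<^sup>2 = T * real P"
          using P1 by (simp add: T_def powr_diff power2_eq_square)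
        then show ?thesis by (simp add: algebra_simps)
      qed
      finally show ?case using Suc(2) by (simp add: algebra_simps)
    qed
    have "(\<Sum>p=1..n. b p * (h p)\<^sup>2) \<le> (\<Sum>p=1..n. B * (h p)\<^sup>2)"
      by (intro sum_mono mult_right_mono B) auto
    \<comment> \<open>Extending the range to \<open>max n P\<close> lets \<open>tail\<close> cover
      small \<open>n\<close> too.\<close>
    also have "\<dots> \<le> (\<Sum>p=1..max n P. B * (h p)\<^sup>2)"
      using B0 by (intro sum_mono2) auto
    also have "\<dots> = B * (\<Sum>p=1..max n P. (h p)\<^sup>2)" by (simp add: sum_distrib_left)
    also have "\<dots> \<le> B * (C\<^sup>2 * ((2 / \<gamma> + 1) * T))"
    proof (intro mult_left_mono B0)
      have "C\<^sup>2 * ((2 / \<gamma> + 1) * T - T * real P / real (max n P)) \<le> C\<^sup>2 * ((2 / \<gamma> + 1) * T)"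
        using T by (intro mult_left_mono) auto
      then show "(\<Sum>p=1..max n P. (h p)\<^sup>2) \<le> C\<^sup>2 * ((2 / \<gamma> + 1) * T)"
        using tail[of "max n P"] by simp
    qed
    also have "T \<le> (2 * M / sqrt \<epsilon>) powr \<gamma>"
      unfolding T_def using P P1 gam by (intro powr_mono2) auto
    also have "\<dots> = (2 * M) powr \<gamma> * \<epsilon> powr (- (1 - s / 2))"
      using M eps by (subst inverse_sqrt_powr) (auto simp: \<gamma>_def diff_divide_distrib)
    finally show ?thesis using B0 gam by (simp add: mult_left_mono mult.assoc)
  qed
  then show ?thesis using B0 gam
    by (intro exI[of _ "B * (C\<^sup>2 * ((2 / \<gamma> + 1) * ((2 * M) powr \<gamma>)))"]) auto
qed

text \<open>A single dyadic block \<open>{m<..2 * m}\<close> just below the scale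
  \<open>\<delta> / sqrt \<epsilon>\<close> suffices: it has \<open>m\<close> terms of order at
  least \<open>m powr (\<gamma> - 1)\<close>.\<close>

lemma minimal_square_sum_lower:
  "\<exists>c>0. \<exists>\<epsilon>\<^sub>0>0. \<forall>\<epsilon>>0. \<epsilon> < \<epsilon>\<^sub>0 \<longrightarrow> (\<forall>h. minimal_harmonic b (1 + \<epsilon>) h \<longrightarrow> h 0 = g 0 \<longrightarrow>
     (\<exists>n. c * \<epsilon> powr (- (1 - s / 2)) \<le> (\<Sum>p=1..n. b p * (h p)\<^sup>2)))"
proof -
  define \<gamma> where "\<gamma> = 2 - s"
  have gam: "0 < \<gamma>" "\<gamma> < 2" using s by (auto simp: \<gamma>_def)
  have a2: "(x powr a)\<^sup>2 = x powr (\<gamma> - 1)" for x :: real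
    by (simp add: a_def \<gamma>_def power2_eq_square powr_add[symmetric])
  obtain k \<delta> N1 where k: "k > 0" "\<delta> > 0" "\<And>\<epsilon> h p. \<epsilon> > 0 \<Longrightarrow> \<epsilon> \<le> 1 \<Longrightarrow> minimal_harmonic b (1 + \<epsilon>) h \<Longrightarrow>
      h 0 = g 0 \<Longrightarrow> p \<ge> N1 \<Longrightarrow> real p \<le> \<delta> / sqrt \<epsilon> \<Longrightarrow> k * real p powr a \<le> h p"
    using minimal_ge_powr by blast
  obtain N2 where N2: "\<And>p. p \<ge> N2 \<Longrightarrow> b p \<ge> 1 / 2"
    using b_bounds unfolding eventually_sequentially by blast
  define N where "N = max N1 N2"
  \<comment> \<open>This forces \<open>\<delta> / sqrt \<epsilon> > 2 * N + 4\<close>, so the block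
    starts beyond \<open>N\<close> and rounding loses at most a factor 2.\<close>
  define \<epsilon>\<^sub>0 where "\<epsilon>\<^sub>0 = min 1 ((\<delta> / (2 * real N + 4))\<^sup>2)"
  have "\<exists>n. k\<^sup>2 / 8 * (\<delta> / 2) powr \<gamma> * \<epsilon> powr (- (1 - s / 2)) \<le> (\<Sum>p=1..n. b p * (h p)\<^sup>2)"
    if eps: "\<epsilon> > 0" "\<epsilon> < \<epsilon>\<^sub>0" and h: "minimal_harmonic b (1 + \<epsilon>) h" "h 0 = g 0" for \<epsilon> h
  proof -
    have eps1: "\<epsilon> \<le> 1" using eps by (simp add: \<epsilon>\<^sub>0_def)
    have "sqrt \<epsilon> < \<delta> / (2 * real N + 4)"
      using eps k(2) by (intro real_less_lsqrt) (auto simp: \<epsilon>\<^sub>0_def)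
    then have big: "2 * real N + 4 < \<delta> / sqrt \<epsilon>"
      using eps k(2) by (simp add: field_simps)
    define z where "z = \<delta> / sqrt \<epsilon>"
    define m where "m = nat \<lfloor>z / 2\<rfloor>"
    have "real m \<le> z / 2" "z / 2 - 1 < real m"
      using big unfolding m_def z_def[symmetric] by linarith+
    then have m: "real (2 * m) \<le> \<delta> / sqrt \<epsilon>" "real (2 * m) \<ge> \<delta> / sqrt \<epsilon> / 2" "m \<ge> N" "m \<ge> 1"
      using big unfolding z_def[symmetric] by linarith+
    define Y where "Y = real (2 * m) powr (\<gamma> - 1)"
    \<comment> \<open>One factor 1/2 comes from \<open>b p\<close>, the other from comparing
      \<open>real p powr (\<gamma> - 1)\<close> with its value at the right end of the
      block.\<close>
    have each: "k\<^sup>2 / 4 * Y \<le> b p * (h p)\<^sup>2" if p: "p \<in> {m<..2 * m}" for p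
    proof -
      have Y: "Y / 2 \<le> real p powr (\<gamma> - 1)"
      proof (cases "\<gamma> \<ge> 1")
        case True
        have "Y \<le> (2 * real p) powr (\<gamma> - 1)"
          unfolding Y_def using True p by (intro powr_mono2) auto
        also have "\<dots> = 2 powr (\<gamma> - 1) * real p powr (\<gamma> - 1)" by (simp add: powr_mult)
        also have "\<dots> \<le> 2 powr 1 * real p powr (\<gamma> - 1)"
          using gam by (intro mult_right_mono powr_mono) auto
        finally show ?thesis by simp
      next
        case False
        then have "Y \<le> real p powr (\<gamma> - 1)" unfolding Y_def using p m by (intro powr_mono2') auto
        then show ?thesis by (simp add: Y_def) (smt (verit) powr_ge_zero)
      qed
      have "k * real p powr a \<le> h p"
        using p m by (intro k(3)[OF eps(1) eps1 h]) (auto simp: N_def)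
      then have "(k * real p powr a)\<^sup>2 \<le> (h p)\<^sup>2" using k(1) by (intro power_mono) auto
      then have "k\<^sup>2 * real p powr (\<gamma> - 1) \<le> (h p)\<^sup>2"
        by (simp add: power_mult_distrib a2)
      moreover have "k\<^sup>2 * (Y / 2) \<le> k\<^sup>2 * real p powr (\<gamma> - 1)" using Y by (intro mult_left_mono) auto
      moreover have "1 / 2 * (h p)\<^sup>2 \<le> b p * (h p)\<^sup>2"
        using N2[of p] p m by (intro mult_right_mono) (auto simp: N_def)
      ultimately show ?thesis by simp
    qed
    have "(\<delta> / 2) powr \<gamma> * \<epsilon> powr (- (1 - s / 2)) = (\<delta> / 2 / sqrt \<epsilon>) powr \<gamma>"
      using k eps by (subst inverse_sqrt_powr) (auto simp: \<gamma>_def diff_divide_distrib)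
    also have "\<dots> \<le> real (2 * m) powr \<gamma>"
      using m(2) gam k eps by (intro powr_mono2) auto
    also have "\<dots> = 2 * real m * Y" using m(4) by (simp add: Y_def powr_diff)
    finally have "k\<^sup>2 / 8 * ((\<delta> / 2) powr \<gamma> * \<epsilon> powr (- (1 - s / 2))) \<le> k\<^sup>2 / 8 * (2 * real m * Y)"
      by (intro mult_left_mono) auto
    also have "\<dots> = (\<Sum>p\<in>{m<..2 * m}. k\<^sup>2 / 4 * Y)" by simp
    also have "\<dots> \<le> (\<Sum>p\<in>{m<..2 * m}. b p * (h p)\<^sup>2)" by (intro sum_mono each)
    also have "\<dots> \<le> (\<Sum>p=1..2 * m. b p * (h p)\<^sup>2)"
      by (intro sum_mono2) (auto intro!: mult_nonneg_nonneg less_imp_le[OF b_pos])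
    finally show ?thesis by (auto simp: mult.assoc)
  qed
  moreover have "\<epsilon>\<^sub>0 > 0" using k(2) by (simp add: \<epsilon>\<^sub>0_def)
  moreover have "k\<^sup>2 / 8 * (\<delta> / 2) powr \<gamma> > 0" using k by simp
  ultimately show ?thesis
    by (intro exI[of _ "k\<^sup>2 / 8 * (\<delta> / 2) powr \<gamma>"] conjI exI[of _ \<epsilon>\<^sub>0]) auto
qed

end

section \<open>Return to \<open>min_sol\<close> and the limits in \<epsilon>\<close>

lemma pos_solution_of_harmonic:
  assumes b: "\<And>n. n \<ge> 1 \<Longrightarrow> b n > 0" and "u 0 = 2 * sqrt (b 1)"
    and "\<And>p. u p > 0" "\<And>p. p \<ge> 1 \<Longrightarrow> defect b \<rho> u p = 0"
  shows "pos_solution b \<rho> (\<lambda>p. sqrt (b p) * u p)"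
  using assms(3,4) pos_solution_iff_renorm[OF b] renorm_surj[of b u, OF b assms(2)] by simp

text \<open>The infimum is finite because the solution at \<open>1 + \<epsilon>\<close> with the
  initial data of \<open>g\<close> stays positive, by \<open>harmonic_from_pos\<close>. Minimality
  transfers because first entries are only rescaled by \<open>sqrt (b 1)\<close>.\<close>

lemma min_sol_minimal_harmonic:
  assumes b: "\<And>n. n \<ge> 1 \<Longrightarrow> b n > 0" and "R_transient b 1" "\<epsilon> > 0"
  shows "minimal_harmonic b (1 + \<epsilon>) (renorm b (min_sol b (1 + \<epsilon>)))"
proof -
  obtain v where v: "pos_solution b 1 v" using assms(2) by (auto simp: R_transient_def)
  define g where "g = renorm b v"
  interpret positive_harmonic b g
    using v b pos_solution_iff_renorm[OF b] by unfold_locales (auto simp: g_def)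
  define u where "u = harmonic_from b (1 + \<epsilon>) (g 0) (g 1)"
  have u0: "u 0 = 2 * sqrt (b 1)" by (simp add: u_def g_def renorm_def)
  have u_pos: "u p > 0" for p
  proof (cases p)
    case 0
    then show ?thesis using g_pos by (simp add: u_def)
  next
    case (Suc n)
    then show ?thesis
      unfolding u_def Suc using g_pos[of 0] g_pos[of 1] by (intro harmonic_from_pos assms) auto
  qed
  have "pos_solution b (1 + \<epsilon>) (\<lambda>p. sqrt (b p) * u p)"
    using u0 u_pos defect_harmonic_from
    by (intro pos_solution_of_harmonic[OF b]) (auto simp: u_def)
  then have "min_first b (1 + \<epsilon>) \<le> ereal (sqrt (b 1) * u 1)"
    unfolding min_first_def by (intro Inf_lower CollectI exI[of _ "\<lambda>p. sqrt (b p) * u p"]) simp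
  then have "min_first b (1 + \<epsilon>) < \<infinity>" by (rule le_less_trans) simp
  from min_solution[OF b this] have m: "pos_solution b (1 + \<epsilon>) (min_sol b (1 + \<epsilon>))"
    "ereal (min_sol b (1 + \<epsilon>) 1) = min_first b (1 + \<epsilon>)" by auto
  have "renorm b (min_sol b (1 + \<epsilon>)) 1 \<le> y 1"
    if y: "\<forall>p. y p > 0" "\<forall>p\<ge>1. defect b (1 + \<epsilon>) y p = 0" "y 0 = renorm b (min_sol b (1 + \<epsilon>)) 0" for y
  proof -
    have "pos_solution b (1 + \<epsilon>) (\<lambda>p. sqrt (b p) * y p)"
      using y by (intro pos_solution_of_harmonic[OF b]) (auto simp: renorm_def)
    then have "min_first b (1 + \<epsilon>) \<le> ereal (sqrt (b 1) * y 1)"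
      unfolding min_first_def by (intro Inf_lower CollectI exI[of _ "\<lambda>p. sqrt (b p) * y p"]) simp
    then have "min_sol b (1 + \<epsilon>) 1 \<le> sqrt (b 1) * y 1" unfolding m(2)[symmetric] by simp
    then show ?thesis using b[of 1] by (simp add: renorm_def pos_divide_le_eq mult.commute)
  qed
  then show ?thesis
    using m(1) pos_solution_iff_renorm[OF b] unfolding minimal_harmonic_def by simp
qed

theorem theorem4:
  fixes b :: "nat \<Rightarrow> real" and w \<zeta> \<theta> :: real
  assumes b_pos: "\<And>n. n \<ge> 1 \<Longrightarrow> b n > 0"
    and zeta: "0 < \<zeta>" "\<zeta> \<le> 1"
    and b_asymp: "(\<lambda>n. b n - (1 - w / (real n)\<^sup>2)) \<in> O(\<lambda>n. real n powr (-2 - \<zeta>))"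
    and w_range: "-3/8 < w" "w < 1/8"
    and transient: "R_transient b 1"
    and theta: "\<theta> = 1 - sqrt (1 - 8 * w) / 2"
  shows "0 < Liminf (at_right 0)
             (\<lambda>\<epsilon>::real. ennreal (\<epsilon> powr \<theta>) * (\<Sum>p. ennreal ((min_sol b (1 + \<epsilon>) (Suc p))\<^sup>2)))
       \<and> Liminf (at_right 0)
             (\<lambda>\<epsilon>::real. ennreal (\<epsilon> powr \<theta>) * (\<Sum>p. ennreal ((min_sol b (1 + \<epsilon>) (Suc p))\<^sup>2)))
         \<le> Limsup (at_right 0)
             (\<lambda>\<epsilon>::real. ennreal (\<epsilon> powr \<theta>) * (\<Sum>p. ennreal ((min_sol b (1 + \<epsilon>) (Suc p))\<^sup>2)))
       \<and> Limsup (at_right 0)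
             (\<lambda>\<epsilon>::real. ennreal (\<epsilon> powr \<theta>) * (\<Sum>p. ennreal ((min_sol b (1 + \<epsilon>) (Suc p))\<^sup>2))) < \<infinity>"
proof -
  define s where "s = sqrt (1 - 8 * w)"
  have s2: "s\<^sup>2 = 1 - 8 * w" using w_range by (simp add: s_def)
  have "s < sqrt (2\<^sup>2)" unfolding s_def using w_range by (intro real_sqrt_less_mono) auto
  then have s: "0 < s" "s < 2" using w_range by (auto simp: s_def)
  have th: "\<theta> = 1 - s / 2" by (simp add: theta s_def)
  obtain v where v: "pos_solution b 1 v" using transient by (auto simp: R_transient_def)
  define g where "g = renorm b v"
  have w_eq: "w = (1 - s\<^sup>2) / 8" by (simp add: s2)
  interpret critical_harmonic b g s \<zeta>
    using v b_pos pos_solution_iff_renorm[OF b_pos] s zeta b_asymp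
    by unfold_locales (auto simp: g_def w_eq)
  define h where "h \<epsilon> = renorm b (min_sol b (1 + \<epsilon>))" for \<epsilon>
  define S where "S \<epsilon> = (\<Sum>p. ennreal ((min_sol b (1 + \<epsilon>) (Suc p))\<^sup>2))" for \<epsilon>
  \<comment> \<open>Both sequences take the value \<open>2 * sqrt (b 1)\<close> at 0, whatever
    solution is renormalised.\<close>
  have h: "minimal_harmonic b (1 + \<epsilon>) (h \<epsilon>)" "h \<epsilon> 0 = g 0" if "\<epsilon> > 0" for \<epsilon>
    unfolding h_def g_def
    using min_sol_minimal_harmonic[OF b_pos transient that] by (auto simp: renorm_def)
  \<comment> \<open>The weights \<open>b p\<close> in the sums undo the division by
    \<open>sqrt (b p)\<close>.\<close>
  have sq: "(min_sol b (1 + \<epsilon>) (Suc p))\<^sup>2 = b (Suc p) * (h \<epsilon> (Suc p))\<^sup>2" for \<epsilon> p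
    using b_pos[of "Suc p"] by (simp add: h_def renorm_def power_divide)
  have partial: "(\<Sum>p<n. ennreal ((min_sol b (1 + \<epsilon>) (Suc p))\<^sup>2)) = ennreal (\<Sum>p=1..n. b p * (h \<epsilon> p)\<^sup>2)" for \<epsilon> n
    by (simp add: sum_ennreal sq[symmetric] sum.atLeast1_atMost_eq)
  obtain C where C: "C \<ge> 0" "\<And>\<epsilon> n. \<epsilon> > 0 \<Longrightarrow> \<epsilon> \<le> 1 \<Longrightarrow> (\<Sum>p=1..n. b p * (h \<epsilon> p)\<^sup>2) \<le> C * \<epsilon> powr (- \<theta>)"
    using minimal_square_sum_upper h unfolding th by metis
  obtain c \<epsilon>\<^sub>0 where c: "c > 0" "\<epsilon>\<^sub>0 > 0"
    "\<And>\<epsilon>. \<epsilon> > 0 \<Longrightarrow> \<epsilon> < \<epsilon>\<^sub>0 \<Longrightarrow> \<exists>n. c * \<epsilon> powr (- \<theta>) \<le> (\<Sum>p=1..n. b p * (h \<epsilon> p)\<^sup>2)"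
    using minimal_square_sum_lower h unfolding th by metis
  have scale: "ennreal (\<epsilon> powr \<theta>) * ennreal (x * \<epsilon> powr (- \<theta>)) = ennreal x" if "\<epsilon> > 0" "x \<ge> 0" for \<epsilon> x
    using that by (simp add: ennreal_mult[symmetric] powr_minus_divide)
  \<comment> \<open>In \<open>ennreal\<close> the series always has a value, so a bound on all
    partial sums is enough.\<close>
  have up: "ennreal (\<epsilon> powr \<theta>) * S \<epsilon> \<le> ennreal C" if "\<epsilon> > 0" "\<epsilon> \<le> 1" for \<epsilon>
  proof -
    have "S \<epsilon> \<le> ennreal (C * \<epsilon> powr (- \<theta>))"
      unfolding S_def using C(2)[OF that]
      by (intro suminf_le_const summableI) (simp only: partial ennreal_leI)
    then show ?thesis using scale[OF that(1) C(1)] by (metis mult_left_mono zero_le)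
  qed
  have low: "ennreal c \<le> ennreal (\<epsilon> powr \<theta>) * S \<epsilon>" if eps: "\<epsilon> > 0" "\<epsilon> < \<epsilon>\<^sub>0" for \<epsilon>
  proof -
    obtain n where "c * \<epsilon> powr (- \<theta>) \<le> (\<Sum>p=1..n. b p * (h \<epsilon> p)\<^sup>2)" using c(3)[OF eps] by blast
    then have "ennreal (c * \<epsilon> powr (- \<theta>)) \<le> (\<Sum>p<n. ennreal ((min_sol b (1 + \<epsilon>) (Suc p))\<^sup>2))"
      unfolding partial by (rule ennreal_leI)
    also have "\<dots> \<le> S \<epsilon>" unfolding S_def by (intro sum_le_suminf summableI) auto
    finally show ?thesis using scale[OF eps(1), of c] c(1) by (metis less_imp_le mult_left_mono zero_le)
  qed
  let ?F = "\<lambda>\<epsilon>. ennreal (\<epsilon> powr \<theta>) * S \<epsilon>"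
  have "eventually (\<lambda>\<epsilon>. \<epsilon> \<in> {0<..<min 1 \<epsilon>\<^sub>0}) (at_right (0::real))"
    using c(2) by (intro eventually_at_right_real) auto
  then have ev: "eventually (\<lambda>\<epsilon>. ennreal c \<le> ?F \<epsilon>) (at_right 0)"
    "eventually (\<lambda>\<epsilon>. ?F \<epsilon> \<le> ennreal C) (at_right 0)"
    by (eventually_elim, use up low in auto)+
  have "0 < ennreal c" using c by simp
  also have "\<dots> \<le> Liminf (at_right 0) ?F" using ev(1) by (rule Liminf_bounded)
  finally have "0 < Liminf (at_right 0) ?F" .
  moreover have "Liminf (at_right 0) ?F \<le> Limsup (at_right 0) ?F"
    by (rule Liminf_le_Limsup) simp
  moreover have "Limsup (at_right 0) ?F \<le> ennreal C" using ev(2) by (rule Limsup_bounded)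
  then have "Limsup (at_right 0) ?F < \<infinity>" by (simp add: le_less_trans)
  ultimately show ?thesis unfolding S_def by blast
qed

end
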